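(* Let $(\mathcal{H},\Lambda)$ be a Hopf Galois order setting over a field $\Bbbk$, let $F$ be an $\mathcal{H}$-Galois $\Lambda$-order, and let $\mathfrak{m}$ be a maximal ideal of $\Lambda$ of finite codimension. Let $V$ be a left Harish-Chandra module over $F$ with respect to $\Lambda$. Suppose that there exists an integer $r\ge 0$ such that the following two conditions hold: (i) $V=F_r v_{\mathfrak{m}}$ for some $v_{\mathfrak{m}}\in V^{\mathfrak{m}}$; (ii) $\dim_{\Bbbk}\mathrm{Stab}(\mathcal{H}_r,\mathfrak{m})<\infty$. Then $\dim_{\Bbbk}V^{\mathfrak{m}}<\infty$.
   Context: Let $\Bbbk$ be an arbitrary field; all algebras are over $\Bbbk$ and $\otimes=\otimes_{\Bbbk}$. A Hopf Galois order setting (or setting) is a pair $(\mathcal{H},\Lambda)$ where $\mathcal{H}$ is a left coideal subalgebra (a subalgebra with $\Delta(\mathcal{H})\subset\tilde{\mathcal{H}}\otimes\mathcal{H}$) of a Hopf algebra $\tilde{\mathcal{H}}$ (which is part of the data) with comultiplication $\Delta(x)=x_{(1)}\otimes x_{(2)}$, counit $\varepsilon$ and invertible antipode $S$, and $\Lambda$ is a left $\tilde{\mathcal{H}}$-module algebra (action denoted $x\triangleright a$) such that (i) $\Lambda$ is a noetherian (commutative) integral domain; (ii) the action of $\tilde{\mathcal{H}}$ on $\Lambda$ extends to an action on the field of fractions $L=\mathrm{Frac}(\Lambda)$ (also denoted $\triangleright$); (iii) $\Lambda$ is faithful as a left module over the smash product $\Lambda\#\mathcal{H}$. The smash product $A\#\mathcal{H}$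 (for $A=\Lambda$ or $L$) is the algebra containing $A$ and $\mathcal{H}$ as subalgebras such that $A\otimes\mathcal{H}\to A\#\mathcal{H}$, $a\otimes x\mapsto ax$, is a vector space isomorphism and $xa=(x_{(1)}\triangleright a)x_{(2)}$ for $x\in\mathcal{H}$, $a\in A$. For $X\in L\#\tilde{\mathcal{H}}$, $\hat X$ denotes the corresponding linear endomorphism of $L$, determined by $\hat f(g)=fg$ for $f,g\in L$ and $\hat x(f)=x\triangleright f$ for $x\in\tilde{\mathcal{H}}$. An $\mathcal{H}$-Galois $\Lambda$-order is a subalgebra $F\subset L\#\mathcal{H}$ such that $\Lambda\subset F$, $LF=L\#\mathcal{H}$, and $\hat X(\Lambda)\subset\Lambda$ for all $X\in F$. For a left $F$-module $V$ and a maximal ideal $\mathfrak{m}$ of $\Lambda$, put $V^{\mathfrak{m}}=\{v\in V\mid \mathfrak{m}^Nv=0 \text{ for } N\gg 0\}$. $V$ is a Harish-Chandra module (with respect to $\Lambda$) if $V=\bigoplus V^{\mathfrak{m}}$, the sum being over all maximal ideals $\mathfrak{m}$ of $\Lambda$ of finite codimension. Filtrations: $\{\tilde{\mathcal{H}}_r\}_{r=0}^\infty$ is the coradical filtration of $\tilde{\mathcal{H}}$, $\mathcal{H}_r=\mathcal{H}\cap\Delta^{-1}(\tilde{\mathcal{H}}_r\otimes\mathcal{H})$ (a left coideal of $\tilde{\mathcal{H}}$ contained in $\mathcal{H}$), and $F_r=F\cap(L\mathcal{H}_r)$. Stabilizer. For a subcoalgebra $\mathcal{C}$ of $\tilde{\mathcal{H}}$,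 an element $R=\sum_i r_i\otimes s_i\in\Lambda\otimes\Lambda$ is a reductor for $\mathcal{C}$ mod $\mathfrak{m}$ if (R1) the image of $R$ in $\Lambda\otimes\Lambda/(\Lambda\otimes\mathfrak{m}+\mathfrak{m}\otimes\Lambda)$ is invertible, and (R2) $\sum_i r_i\cdot(x\triangleright s_i)=0$ for all $x\in\mathcal{C}$. $\mathcal{C}$ is superfluous mod $\mathfrak{m}$ if for every finite-dimensional subcoalgebra $\mathcal{C}'$ of $\mathcal{C}$ there exists a reductor for $\mathcal{C}'$ mod $\mathfrak{m}$. $\mathcal{S}(\tilde{\mathcal{H}},\mathfrak{m})$ is the sum of all subcoalgebras of $\tilde{\mathcal{H}}$ that are superfluous mod $\mathfrak{m}$. For a left coideal $\mathcal{C}\subset\tilde{\mathcal{H}}$, $\mathcal{S}(\mathcal{C},\mathfrak{m})=\{x\in\mathcal{C}\mid\Delta(x)\in\mathcal{S}(\tilde{\mathcal{H}},\mathfrak{m})\otimes\mathcal{C}\}$ and $\mathrm{Stab}(\mathcal{C},\mathfrak{m})=\mathcal{C}/\mathcal{S}(\mathcal{C},\mathfrak{m})$. *)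

theory Defs
  imports
    "HOL-Library.Poly_Mapping"
    "HOL-Computational_Algebra.Polynomial_Factorial"
begin

section \<open>Linear algebra over a field\<close>

text \<open>
  Vector spaces are pairs of a type of class \<^class>\<open>ab_group_add\<close> and a scalar multiplication,
  as in \<^locale>\<open>vector_space\<close>; \<open>k\<close> is the type \<open>'k\<close> of class \<^class>\<open>field\<close>.
\<close>

definition fin_dim :: "('k::field \<Rightarrow> 'v::ab_group_add \<Rightarrow> 'v) \<Rightarrow> 'v set \<Rightarrow> bool"
  where "fin_dim s A \<longleftrightarrow> (\<exists>B. finite B \<and> B \<subseteq> A \<and> A \<subseteq> module.span s B)"

text \<open>Finite-dimensionality of the quotient \<open>A/N\<close> for subspaces \<open>N \<subseteq> A\<close>:
  the classes of finitely many elements of \<open>A\<close> span it.\<close>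

definition fin_dim_quotient :: "('k::field \<Rightarrow> 'v::ab_group_add \<Rightarrow> 'v) \<Rightarrow> 'v set \<Rightarrow> 'v set \<Rightarrow> bool"
  where "fin_dim_quotient s A N \<longleftrightarrow>
    (\<exists>B. finite B \<and> B \<subseteq> A \<and> (\<forall>x\<in>A. \<exists>y\<in>module.span s B. x - y \<in> N))"


section \<open>Tensor products\<close>

text \<open>
  \<open>V \<otimes> W\<close> is the free vector space \<open>('v \<times> 'w) \<Rightarrow>\<^sub>0 'k\<close> of formal sums modulo the subspace
  \<open>tensor_null\<close> spanned by the bilinearity relations.  Elements of \<open>V \<otimes> W\<close> are handled through
  representing formal sums, and equality in \<open>V \<otimes> W\<close> is \<open>tensor_eq\<close>.  Accordingly a map into
  \<open>V \<otimes> W\<close>, such as a comultiplication, is given by a choice of representatives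
  (a Sweedler presentation), and is only constrained up to \<open>tensor_eq\<close>.
\<close>

definition fsmult :: "'k::field \<Rightarrow> ('b \<Rightarrow>\<^sub>0 'k) \<Rightarrow> ('b \<Rightarrow>\<^sub>0 'k)"
  where "fsmult c p = Poly_Mapping.map ((*) c) p"

definition pure_tensor :: "'v \<Rightarrow> 'w \<Rightarrow> ('v \<times> 'w) \<Rightarrow>\<^sub>0 'k::field"
  where "pure_tensor v w = Poly_Mapping.single (v, w) 1"

definition tensor_null ::
  "('k::field \<Rightarrow> 'v::ab_group_add \<Rightarrow> 'v) \<Rightarrow> ('k \<Rightarrow> 'w::ab_group_add \<Rightarrow> 'w) \<Rightarrow> (('v \<times> 'w) \<Rightarrow>\<^sub>0 'k) set"
  where "tensor_null sV sW = module.span fsmult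
    ({pure_tensor (v + v') w - pure_tensor v w - pure_tensor v' w | v v' w. True} \<union>
     {pure_tensor v (w + w') - pure_tensor v w - pure_tensor v w' | v w w'. True} \<union>
     {pure_tensor (sV c v) w - fsmult c (pure_tensor v w) | c v w. True} \<union>
     {pure_tensor v (sW c w) - fsmult c (pure_tensor v w) | c v w. True})"

definition tensor_eq ::
  "('k::field \<Rightarrow> 'v::ab_group_add \<Rightarrow> 'v) \<Rightarrow> ('k \<Rightarrow> 'w::ab_group_add \<Rightarrow> 'w) \<Rightarrow>
    (('v \<times> 'w) \<Rightarrow>\<^sub>0 'k) \<Rightarrow> (('v \<times> 'w) \<Rightarrow>\<^sub>0 'k) \<Rightarrow> bool"
  where "tensor_eq sV sW p q \<longleftrightarrow> p - q \<in> tensor_null sV sW"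

text \<open>The linear map on formal sums extending \<open>v \<otimes> w \<mapsto> f v w\<close>.\<close>

definition bilift ::
  "('k::field \<Rightarrow> 'u::ab_group_add \<Rightarrow> 'u) \<Rightarrow> ('v \<Rightarrow> 'w \<Rightarrow> 'u) \<Rightarrow> (('v \<times> 'w) \<Rightarrow>\<^sub>0 'k) \<Rightarrow> 'u"
  where "bilift sU f p =
    (\<Sum>z\<in>Poly_Mapping.keys p. sU (Poly_Mapping.lookup p z) (f (fst z) (snd z)))"

text \<open>The formal sums representing an element of \<open>A \<otimes> B \<subseteq> V \<otimes> W\<close>, for subspaces \<open>A\<close> and \<open>B\<close>.\<close>

definition tensor_sub ::
  "('k::field \<Rightarrow> 'v::ab_group_add \<Rightarrow> 'v) \<Rightarrow> ('k \<Rightarrow> 'w::ab_group_add \<Rightarrow> 'w) \<Rightarrow>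
    'v set \<Rightarrow> 'w set \<Rightarrow> (('v \<times> 'w) \<Rightarrow>\<^sub>0 'k) set"
  where "tensor_sub sV sW A B =
    {p. \<exists>q. Poly_Mapping.keys q \<subseteq> A \<times> B \<and> tensor_eq sV sW p q}"

text \<open>\<open>(a \<otimes> b)(c \<otimes> d) = ac \<otimes> bd\<close>\<close>

definition tensor_mult ::
  "(('a::times \<times> 'b::times) \<Rightarrow>\<^sub>0 'k::field) \<Rightarrow> (('a \<times> 'b) \<Rightarrow>\<^sub>0 'k) \<Rightarrow> (('a \<times> 'b) \<Rightarrow>\<^sub>0 'k)"
  where "tensor_mult p q =
    bilift fsmult (\<lambda>a b. bilift fsmult (\<lambda>c d. pure_tensor (a * c) (b * d)) q) p"

definition pure_tensor3 :: "'u \<Rightarrow> 'v \<Rightarrow> 'w \<Rightarrow> ('u \<times> 'v \<times> 'w) \<Rightarrow>\<^sub>0 'k::field"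
  where "pure_tensor3 u v w = Poly_Mapping.single (u, v, w) 1"

definition tensor_null3 :: "('k::field \<Rightarrow> 'v::ab_group_add \<Rightarrow> 'v) \<Rightarrow> (('v \<times> 'v \<times> 'v) \<Rightarrow>\<^sub>0 'k) set"
  where "tensor_null3 s = module.span fsmult
    ({pure_tensor3 (u + u') v w - pure_tensor3 u v w - pure_tensor3 u' v w | u u' v w. True} \<union>
     {pure_tensor3 u (v + v') w - pure_tensor3 u v w - pure_tensor3 u v' w | u v v' w. True} \<union>
     {pure_tensor3 u v (w + w') - pure_tensor3 u v w - pure_tensor3 u v w' | u v w w'. True} \<union>
     {pure_tensor3 (s c u) v w - fsmult c (pure_tensor3 u v w) | c u v w. True} \<union>
     {pure_tensor3 u (s c v) w - fsmult c (pure_tensor3 u v w) | c u v w. True} \<union>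
     {pure_tensor3 u v (s c w) - fsmult c (pure_tensor3 u v w) | c u v w. True})"

lemma lookup_fsmult [simp]:
  "Poly_Mapping.lookup (fsmult c p) z = c * Poly_Mapping.lookup p z"
  by (simp add: fsmult_def Poly_Mapping.map.rep_eq when_def)

lemma vector_space_fsmult: "vector_space (fsmult :: 'k::field \<Rightarrow> ('b \<Rightarrow>\<^sub>0 'k) \<Rightarrow> _)"
  by unfold_locales (auto intro!: poly_mapping_eqI simp: lookup_add algebra_simps)

lemma bilift_superset:
  assumes "vector_space sU" "finite A" "Poly_Mapping.keys p \<subseteq> A"
  shows "bilift sU f p = (\<Sum>z\<in>A. sU (Poly_Mapping.lookup p z) (f (fst z) (snd z)))"
proof -
  interpret vector_space sU by fact
  show ?thesis unfolding bilift_def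
    using assms(2,3) by (intro sum.mono_neutral_left) (auto simp: in_keys_iff)
qed

lemma bilift_add:
  assumes "vector_space sU"
  shows "bilift sU f (p + q) = bilift sU f p + bilift sU f q"
proof -
  interpret vector_space sU by fact
  let ?A = "Poly_Mapping.keys p \<union> Poly_Mapping.keys q"
  have pq: "Poly_Mapping.keys (p + q) \<subseteq> ?A" by (rule keys_add)
  have "bilift sU f (p + q) =
      (\<Sum>z\<in>?A. sU (Poly_Mapping.lookup (p + q) z) (f (fst z) (snd z)))"
    by (rule bilift_superset[OF assms _ pq]) simp
  moreover have "bilift sU f p = (\<Sum>z\<in>?A. sU (Poly_Mapping.lookup p z) (f (fst z) (snd z)))"
    by (rule bilift_superset[OF assms]) auto
  moreover have "bilift sU f q = (\<Sum>z\<in>?A. sU (Poly_Mapping.lookup q z) (f (fst z) (snd z)))"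
    by (rule bilift_superset[OF assms]) auto
  ultimately show ?thesis
    by (simp only: lookup_add scale_left_distrib sum.distrib)
qed

lemma bilift_fsmult:
  assumes "vector_space sU"
  shows "bilift sU f (fsmult c p) = sU c (bilift sU f p)"
proof -
  interpret vector_space sU by fact
  have "Poly_Mapping.keys (fsmult c p) \<subseteq> Poly_Mapping.keys p"
    by (auto simp: in_keys_iff)
  then have "bilift sU f (fsmult c p) =
      (\<Sum>z\<in>Poly_Mapping.keys p. sU (Poly_Mapping.lookup (fsmult c p) z) (f (fst z) (snd z)))"
    by (intro bilift_superset[OF assms]) auto
  then show ?thesis
    unfolding bilift_def[of sU f p] by (simp add: scale_sum_right)
qed

lemma linear_bilift:
  assumes "vector_space sU"
  shows "Vector_Spaces.linear fsmult sU (bilift sU f)"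
  using assms vector_space_fsmult bilift_add[OF assms] bilift_fsmult[OF assms]
  by (intro Vector_Spaces.linear.intro module_hom.intro module_hom_axioms.intro)
     (auto simp: module_iff_vector_space)

lemma bilift_pure [simp]:
  assumes "vector_space sU"
  shows "bilift sU f (pure_tensor v w) = f v w"
proof -
  interpret vector_space sU by fact
  show ?thesis by (simp add: bilift_def pure_tensor_def)
qed

lemma bilift_tensor_null:
  assumes U: "vector_space sU"
    and l: "\<And>w. Vector_Spaces.linear sV sU (\<lambda>v. f v w)"
    and r: "\<And>v. Vector_Spaces.linear sW sU (f v)"
    and p: "p \<in> tensor_null sV sW"
  shows "bilift sU f p = 0"
proof -
  interpret B: Vector_Spaces.linear fsmult sU "bilift sU f" by (rule linear_bilift[OF U])
  have ladd: "f (v + v') w = f v w + f v' w" for v v' w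
    using l[of w] by (simp add: Vector_Spaces.linear_iff)
  have lsc: "f (sV c v) w = sU c (f v w)" for c v w
    using l[of w] by (simp add: Vector_Spaces.linear_iff)
  have radd: "f v (w + w') = f v w + f v w'" for v w w'
    using r[of v] by (simp add: Vector_Spaces.linear_iff)
  have rsc: "f v (sW c w) = sU c (f v w)" for c v w
    using r[of v] by (simp add: Vector_Spaces.linear_iff)
  show ?thesis
    by (rule B.eq_0_on_span[OF _ p[unfolded tensor_null_def]])
       (auto simp: B.diff B.scale bilift_pure[OF U] ladd lsc radd rsc)
qed


section \<open>Algebras\<close>

locale k_algebra = vector_space scale
  for scale :: "'k::field \<Rightarrow> 'a::ring_1 \<Rightarrow> 'a" +
  assumes scale_mult_left: "scale c x * y = scale c (x * y)"
    and scale_mult_right: "x * scale c y = scale c (x * y)"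

definition subalgebra :: "('k::field \<Rightarrow> 'a::ring_1 \<Rightarrow> 'a) \<Rightarrow> 'a set \<Rightarrow> bool"
  where "subalgebra s A \<longleftrightarrow> module.subspace s A \<and> 1 \<in> A \<and> (\<forall>x\<in>A. \<forall>y\<in>A. x * y \<in> A)"

definition algebra_hom ::
  "('k::field \<Rightarrow> 'a::ring_1 \<Rightarrow> 'a) \<Rightarrow> ('k \<Rightarrow> 'b::ring_1 \<Rightarrow> 'b) \<Rightarrow> ('a \<Rightarrow> 'b) \<Rightarrow> bool"
  where "algebra_hom s t f \<longleftrightarrow>
    Vector_Spaces.linear s t f \<and> f 1 = 1 \<and> (\<forall>x y. f (x * y) = f x * f y)"

text \<open>The field of fractions \<^typ>\<open>'a fract\<close> of a commutative \<open>k\<close>-algebra, as a \<open>k\<close>-algebra.\<close>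

definition scale_fract :: "('k::field \<Rightarrow> 'a::idom \<Rightarrow> 'a) \<Rightarrow> 'k \<Rightarrow> 'a fract \<Rightarrow> 'a fract"
  where "scale_fract s c f = to_fract (s c 1) * f"

text \<open>Ideals of a commutative ring are its subspaces as a module over itself.\<close>

definition ideal :: "'a::comm_ring_1 set \<Rightarrow> bool"
  where "ideal I \<longleftrightarrow> module.subspace ((*) :: 'a \<Rightarrow> 'a \<Rightarrow> 'a) I"

definition maximal_ideal :: "'a::comm_ring_1 set \<Rightarrow> bool"
  where "maximal_ideal m \<longleftrightarrow>
    ideal m \<and> m \<noteq> UNIV \<and> (\<forall>J. ideal J \<and> m \<subseteq> J \<longrightarrow> J = m \<or> J = UNIV)"

definition noetherian :: "'a::comm_ring_1 itself \<Rightarrow> bool"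
  where "noetherian _ \<longleftrightarrow>
    (\<forall>I::'a set. ideal I \<longrightarrow> (\<exists>B. finite B \<and> I = module.span ((*) :: 'a \<Rightarrow> 'a \<Rightarrow> 'a) B))"

primrec ideal_power :: "'a::comm_ring_1 set \<Rightarrow> nat \<Rightarrow> 'a set"
  where
    "ideal_power I 0 = UNIV"
  | "ideal_power I (Suc n) =
       module.span ((*) :: 'a \<Rightarrow> 'a \<Rightarrow> 'a) {a * b | a b. a \<in> I \<and> b \<in> ideal_power I n}"


section \<open>Hopf algebras\<close>

locale hopf_algebra = k_algebra sH
  for sH :: "'k::field \<Rightarrow> 'h::ring_1 \<Rightarrow> 'h" +
  fixes \<Delta> :: "'h \<Rightarrow> ('h \<times> 'h) \<Rightarrow>\<^sub>0 'k"
    and \<epsilon> :: "'h \<Rightarrow> 'k"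
    and S :: "'h \<Rightarrow> 'h"
  assumes comult_add: "tensor_eq sH sH (\<Delta> (x + y)) (\<Delta> x + \<Delta> y)"
    and comult_scale: "tensor_eq sH sH (\<Delta> (sH c x)) (fsmult c (\<Delta> x))"
    and coassoc:
      "bilift fsmult (\<lambda>a b. bilift fsmult (\<lambda>c d. pure_tensor3 c d b) (\<Delta> a)) (\<Delta> x) -
       bilift fsmult (\<lambda>a b. bilift fsmult (\<lambda>c d. pure_tensor3 a c d) (\<Delta> b)) (\<Delta> x)
         \<in> tensor_null3 sH"
    and counit_hom: "algebra_hom sH (*) \<epsilon>"
    and counit_left: "bilift sH (\<lambda>a b. sH (\<epsilon> a) b) (\<Delta> x) = x"
    and counit_right: "bilift sH (\<lambda>a b. sH (\<epsilon> b) a) (\<Delta> x) = x"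
    and comult_one: "tensor_eq sH sH (\<Delta> 1) (pure_tensor 1 1)"
    and comult_mult: "tensor_eq sH sH (\<Delta> (x * y)) (tensor_mult (\<Delta> x) (\<Delta> y))"
    and antipode_linear: "Vector_Spaces.linear sH sH S"
    and antipode_left: "bilift sH (\<lambda>a b. S a * b) (\<Delta> x) = sH (\<epsilon> x) 1"
    and antipode_right: "bilift sH (\<lambda>a b. a * S b) (\<Delta> x) = sH (\<epsilon> x) 1"

definition subcoalgebra ::
  "('k::field \<Rightarrow> 'h::ab_group_add \<Rightarrow> 'h) \<Rightarrow> ('h \<Rightarrow> ('h \<times> 'h) \<Rightarrow>\<^sub>0 'k) \<Rightarrow> 'h set \<Rightarrow> bool"
  where "subcoalgebra sH \<Delta> C \<longleftrightarrow>
    module.subspace sH C \<and> (\<forall>x\<in>C. \<Delta> x \<in> tensor_sub sH sH C C)"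

definition simple_subcoalgebra ::
  "('k::field \<Rightarrow> 'h::ab_group_add \<Rightarrow> 'h) \<Rightarrow> ('h \<Rightarrow> ('h \<times> 'h) \<Rightarrow>\<^sub>0 'k) \<Rightarrow> 'h set \<Rightarrow> bool"
  where "simple_subcoalgebra sH \<Delta> C \<longleftrightarrow> subcoalgebra sH \<Delta> C \<and> C \<noteq> {0} \<and>
    (\<forall>D. subcoalgebra sH \<Delta> D \<and> D \<subseteq> C \<longrightarrow> D = {0} \<or> D = C)"

definition coradical ::
  "('k::field \<Rightarrow> 'h::ab_group_add \<Rightarrow> 'h) \<Rightarrow> ('h \<Rightarrow> ('h \<times> 'h) \<Rightarrow>\<^sub>0 'k) \<Rightarrow> 'h set"
  where "coradical sH \<Delta> = module.span sH (\<Union>{C. simple_subcoalgebra sH \<Delta> C})"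

text \<open>\<open>C\<^sub>0\<close> is the coradical and \<open>C\<^bsub>n+1\<^esub> = \<Delta>\<^sup>-\<^sup>1(C \<otimes> C\<^sub>n + C\<^sub>0 \<otimes> C)\<close>.\<close>

primrec coradical_filtration ::
  "('k::field \<Rightarrow> 'h::ab_group_add \<Rightarrow> 'h) \<Rightarrow> ('h \<Rightarrow> ('h \<times> 'h) \<Rightarrow>\<^sub>0 'k) \<Rightarrow> nat \<Rightarrow> 'h set"
  where
    "coradical_filtration sH \<Delta> 0 = coradical sH \<Delta>"
  | "coradical_filtration sH \<Delta> (Suc n) =
       {x. \<exists>p\<in>tensor_sub sH sH UNIV (coradical_filtration sH \<Delta> n).
           \<exists>q\<in>tensor_sub sH sH (coradical sH \<Delta>) UNIV. tensor_eq sH sH (\<Delta> x) (p + q)}"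

definition left_coideal_subalgebra ::
  "('k::field \<Rightarrow> 'h::ring_1 \<Rightarrow> 'h) \<Rightarrow> ('h \<Rightarrow> ('h \<times> 'h) \<Rightarrow>\<^sub>0 'k) \<Rightarrow> 'h set \<Rightarrow> bool"
  where "left_coideal_subalgebra sH \<Delta> H \<longleftrightarrow>
    subalgebra sH H \<and> (\<forall>x\<in>H. \<Delta> x \<in> tensor_sub sH sH UNIV H)"

text \<open>The filtration \<open>H\<^sub>r = H \<inter> \<Delta>\<^sup>-\<^sup>1(H~\<^sub>r \<otimes> H)\<close> of the left coideal subalgebra \<open>H \<subseteq> H~\<close>.\<close>

definition coideal_filtration ::
  "('k::field \<Rightarrow> 'h::ring_1 \<Rightarrow> 'h) \<Rightarrow> ('h \<Rightarrow> ('h \<times> 'h) \<Rightarrow>\<^sub>0 'k) \<Rightarrow> 'h set \<Rightarrow> nat \<Rightarrow> 'h set"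
  where "coideal_filtration sH \<Delta> H r =
    {x\<in>H. \<Delta> x \<in> tensor_sub sH sH (coradical_filtration sH \<Delta> r) H}"

locale module_algebra = hopf_algebra sH \<Delta> \<epsilon> S + A: k_algebra sA
  for sH :: "'k::field \<Rightarrow> 'h::ring_1 \<Rightarrow> 'h" and \<Delta> \<epsilon> S
    and sA :: "'k \<Rightarrow> 'a::ring_1 \<Rightarrow> 'a" +
  fixes act :: "'h \<Rightarrow> 'a \<Rightarrow> 'a"
  assumes act_linear_left: "Vector_Spaces.linear sH sA (\<lambda>x. act x a)"
    and act_linear_right: "Vector_Spaces.linear sA sA (act x)"
    and act_one_left: "act 1 a = a"
    and act_mult_left: "act (x * y) a = act x (act y a)"
    and act_one_right: "act x 1 = sA (\<epsilon> x) 1"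
    and act_mult_right: "act x (a * b) = bilift sA (\<lambda>y z. act y a * act z b) (\<Delta> x)"


section \<open>Smash products\<close>

text \<open>
  \<open>'s\<close> is a model of the smash product \<open>A # H~\<close>, with embeddings \<open>\<iota>A\<close> and \<open>\<iota>H\<close> of \<open>A\<close> and \<open>H~\<close>.
  \<open>smash_mult\<close> is the multiplication map \<open>a \<otimes> x \<mapsto> a x\<close> on formal sums.
\<close>

definition smash_mult ::
  "('k::field \<Rightarrow> 's::ring_1 \<Rightarrow> 's) \<Rightarrow> ('a \<Rightarrow> 's) \<Rightarrow> ('h \<Rightarrow> 's) \<Rightarrow> (('a \<times> 'h) \<Rightarrow>\<^sub>0 'k) \<Rightarrow> 's"
  where "smash_mult sS \<iota>A \<iota>H p = bilift sS (\<lambda>a x. \<iota>A a * \<iota>H x) p"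

locale smash_product = module_algebra sH \<Delta> \<epsilon> S sA act + smash: k_algebra sS
  for sH :: "'k::field \<Rightarrow> 'h::ring_1 \<Rightarrow> 'h" and \<Delta> \<epsilon> S
    and sA :: "'k \<Rightarrow> 'a::ring_1 \<Rightarrow> 'a" and act
    and sS :: "'k \<Rightarrow> 's::ring_1 \<Rightarrow> 's" +
  fixes \<iota>A :: "'a \<Rightarrow> 's" and \<iota>H :: "'h \<Rightarrow> 's"
  assumes hom_A: "algebra_hom sA sS \<iota>A" and inj_A: "inj \<iota>A"
    and hom_H: "algebra_hom sH sS \<iota>H" and inj_H: "inj \<iota>H"
    and smash_mult_inj: "smash_mult sS \<iota>A \<iota>H p = 0 \<Longrightarrow> p \<in> tensor_null sA sH"
    and smash_mult_surj: "\<exists>p. smash_mult sS \<iota>A \<iota>H p = X"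
    and smash_relation: "\<iota>H x * \<iota>A a = bilift sS (\<lambda>y z. \<iota>A (act y a) * \<iota>H z) (\<Delta> x)"

text \<open>The subspace \<open>B C\<close> of \<open>A # H~\<close> for \<open>B \<subseteq> A\<close> and \<open>C \<subseteq> H~\<close>.  If \<open>B\<close> is an \<open>H\<close>-stable subalgebra
  and \<open>C = H\<close>, this is the smash product \<open>B # H\<close>.\<close>

definition smash_sub ::
  "('k::field \<Rightarrow> 's::ring_1 \<Rightarrow> 's) \<Rightarrow> ('a \<Rightarrow> 's) \<Rightarrow> ('h \<Rightarrow> 's) \<Rightarrow> 'a set \<Rightarrow> 'h set \<Rightarrow> 's set"
  where "smash_sub sS \<iota>A \<iota>H B C = module.span sS {\<iota>A b * \<iota>H x | b x. b \<in> B \<and> x \<in> C}"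

text \<open>The endomorphism of \<open>A\<close> attached to \<open>X \<in> A # H~\<close>: if \<open>X = \<Sum>\<^sub>i f\<^sub>i x\<^sub>i\<close>,
  then \<open>g \<mapsto> \<Sum>\<^sub>i f\<^sub>i (x\<^sub>i \<triangleright> g)\<close>; see \<open>smash_hat_eq\<close> for well-definedness.\<close>

definition smash_hat ::
  "('k::field \<Rightarrow> 'a::ring_1 \<Rightarrow> 'a) \<Rightarrow> ('h \<Rightarrow> 'a \<Rightarrow> 'a) \<Rightarrow> ('k \<Rightarrow> 's::ring_1 \<Rightarrow> 's) \<Rightarrow>
    ('a \<Rightarrow> 's) \<Rightarrow> ('h \<Rightarrow> 's) \<Rightarrow> 's \<Rightarrow> 'a \<Rightarrow> 'a"
  where "smash_hat sA act sS \<iota>A \<iota>H X g =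
    (THE y. \<exists>p. smash_mult sS \<iota>A \<iota>H p = X \<and> y = bilift sA (\<lambda>f x. f * act x g) p)"

lemma (in smash_product) smash_hat_eq:
  "smash_hat sA act sS \<iota>A \<iota>H (smash_mult sS \<iota>A \<iota>H p) g = bilift sA (\<lambda>f x. f * act x g) p"
proof -
  let ?f = "\<lambda>f x. f * act x g"
  have A: "vector_space sA" and S: "vector_space sS"
    using A.vector_space_axioms smash.vector_space_axioms .
  interpret B: Vector_Spaces.linear fsmult sA "bilift sA ?f" by (rule linear_bilift[OF A])
  interpret M: Vector_Spaces.linear fsmult sS "smash_mult sS \<iota>A \<iota>H"
    unfolding smash_mult_def[abs_def] by (rule linear_bilift[OF S])
  have l: "Vector_Spaces.linear sA sA (\<lambda>f. ?f f x)" for x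
    using A by (simp add: Vector_Spaces.linear_iff distrib_right A.scale_mult_left)
  have r: "Vector_Spaces.linear sH sA (?f f)" for f
    using A act_linear_left[of g]
    by (simp add: Vector_Spaces.linear_iff distrib_left A.scale_mult_right)
  have *: "bilift sA ?f p = bilift sA ?f q"
    if "smash_mult sS \<iota>A \<iota>H p = smash_mult sS \<iota>A \<iota>H q" for p q
  proof -
    have "p - q \<in> tensor_null sA sH"
      using that by (intro smash_mult_inj) (simp add: M.diff)
    then have "bilift sA ?f (p - q) = 0"
      by (rule bilift_tensor_null[OF A l r])
    then show ?thesis by (simp add: B.diff)
  qed
  show ?thesis unfolding smash_hat_def
  proof (rule the_equality)
    show "\<exists>q. smash_mult sS \<iota>A \<iota>H q = smash_mult sS \<iota>A \<iota>H p \<and> bilift sA ?f p = bilift sA ?f q"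
      by blast
    fix y
    assume "\<exists>q. smash_mult sS \<iota>A \<iota>H q = smash_mult sS \<iota>A \<iota>H p \<and> y = bilift sA ?f q"
    then obtain q where "smash_mult sS \<iota>A \<iota>H q = smash_mult sS \<iota>A \<iota>H p"
      and y: "y = bilift sA ?f q" by blast
    then show "y = bilift sA ?f p" using *[of q p] by (simp only: y)
  qed
qed

lemma (in smash_product) smash_hat_mult:
  "smash_hat sA act sS \<iota>A \<iota>H (\<iota>A f * \<iota>H x) g = f * act x g"
  using smash_hat_eq[of "pure_tensor f x" g]
  unfolding smash_mult_def
  by (simp only: bilift_pure[OF A.vector_space_axioms] bilift_pure[OF smash.vector_space_axioms])


section \<open>Hopf Galois order settings and Galois orders\<close>

text \<open>
  \<open>act\<close> is the action of \<open>H~\<close> on \<open>\<Lambda>\<close> (the type \<open>'a\<close>), \<open>actL\<close> the extended action on \<open>L = Frac \<Lambda>\<close>,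
  and \<open>'s\<close> models \<open>L # H~\<close>.  The subspace \<open>\<Lambda> H\<close> of \<open>L # H~\<close> is the smash product \<open>\<Lambda> # H\<close>;
  it acts on \<open>\<Lambda>\<close> by \<open>smash_hat\<close>.
\<close>

locale hopf_galois_setting =
  \<Lambda>: module_algebra sH \<Delta> \<epsilon> S sA act +
  smash_product sH \<Delta> \<epsilon> S "scale_fract sA" actL sS \<iota>L \<iota>H
  for sH :: "'k::field \<Rightarrow> 'h::ring_1 \<Rightarrow> 'h" and \<Delta> \<epsilon> S
    and sA :: "'k \<Rightarrow> 'a::idom \<Rightarrow> 'a" and act
    and actL :: "'h \<Rightarrow> 'a fract \<Rightarrow> 'a fract"
    and sS :: "'k \<Rightarrow> 's::ring_1 \<Rightarrow> 's" and \<iota>L \<iota>H +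
  fixes H :: "'h set"
  assumes antipode_bij: "bij S"
    and coideal: "left_coideal_subalgebra sH \<Delta> H"
    and noetherian: "noetherian TYPE('a)"
    and act_extends: "actL x (to_fract a) = to_fract (act x a)"
    and faithful: "\<lbrakk>X \<in> smash_sub sS \<iota>L \<iota>H (range to_fract) H;
          \<And>a. smash_hat (scale_fract sA) actL sS \<iota>L \<iota>H X (to_fract a) = 0\<rbrakk> \<Longrightarrow> X = 0"

definition galois_order ::
  "('k::field \<Rightarrow> 'a::idom \<Rightarrow> 'a) \<Rightarrow> ('h \<Rightarrow> 'a fract \<Rightarrow> 'a fract) \<Rightarrow> ('k \<Rightarrow> 's::ring_1 \<Rightarrow> 's) \<Rightarrow>
    ('a fract \<Rightarrow> 's) \<Rightarrow> ('h \<Rightarrow> 's) \<Rightarrow> 'h set \<Rightarrow> 's set \<Rightarrow> bool"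
  where "galois_order sA actL sS \<iota>L \<iota>H H F \<longleftrightarrow>
    subalgebra sS F \<and> F \<subseteq> smash_sub sS \<iota>L \<iota>H UNIV H \<and>
    \<iota>L ` range to_fract \<subseteq> F \<and>
    module.span sS {\<iota>L f * X | f X. X \<in> F} = smash_sub sS \<iota>L \<iota>H UNIV H \<and>
    (\<forall>X\<in>F. \<forall>a. smash_hat (scale_fract sA) actL sS \<iota>L \<iota>H X (to_fract a) \<in> range to_fract)"

text \<open>\<open>F\<^sub>r = F \<inter> L H\<^sub>r\<close>\<close>

definition galois_order_filtration ::
  "('k::field \<Rightarrow> 'h::ring_1 \<Rightarrow> 'h) \<Rightarrow> ('h \<Rightarrow> ('h \<times> 'h) \<Rightarrow>\<^sub>0 'k) \<Rightarrow> ('k \<Rightarrow> 's::ring_1 \<Rightarrow> 's) \<Rightarrow>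
    ('l \<Rightarrow> 's) \<Rightarrow> ('h \<Rightarrow> 's) \<Rightarrow> 'h set \<Rightarrow> 's set \<Rightarrow> nat \<Rightarrow> 's set"
  where "galois_order_filtration sH \<Delta> sS \<iota>L \<iota>H H F r =
    F \<inter> smash_sub sS \<iota>L \<iota>H UNIV (coideal_filtration sH \<Delta> H r)"


section \<open>Harish-Chandra modules\<close>

text \<open>Left modules over the subalgebra \<open>F\<close>; the values of \<open>actV\<close> outside \<open>F\<close> are irrelevant.\<close>

definition left_module ::
  "('k::field \<Rightarrow> 's::ring_1 \<Rightarrow> 's) \<Rightarrow> 's set \<Rightarrow> ('k \<Rightarrow> 'v::ab_group_add \<Rightarrow> 'v) \<Rightarrow> ('s \<Rightarrow> 'v \<Rightarrow> 'v) \<Rightarrow> bool"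
  where "left_module sS F sV actV \<longleftrightarrow>
    vector_space sV \<and>
    (\<forall>X\<in>F. Vector_Spaces.linear sV sV (actV X)) \<and>
    (\<forall>X\<in>F. \<forall>Y\<in>F. \<forall>v. actV (X + Y) v = actV X v + actV Y v) \<and>
    (\<forall>c. \<forall>X\<in>F. \<forall>v. actV (sS c X) v = sV c (actV X v)) \<and>
    (\<forall>v. actV 1 v = v) \<and>
    (\<forall>X\<in>F. \<forall>Y\<in>F. \<forall>v. actV (X * Y) v = actV X (actV Y v))"

definition weight_space ::
  "('a::idom fract \<Rightarrow> 's) \<Rightarrow> ('s \<Rightarrow> 'v::ab_group_add \<Rightarrow> 'v) \<Rightarrow> 'a set \<Rightarrow> 'v set"
  where "weight_space \<iota>L actV m =
    {v. \<exists>N0. \<forall>N\<ge>N0. \<forall>a\<in>ideal_power m N. actV (\<iota>L (to_fract a)) v = 0}"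

text \<open>\<open>V\<close> is the direct sum of its weight spaces at the maximal ideals of finite codimension.\<close>

definition harish_chandra ::
  "('k::field \<Rightarrow> 'a::idom \<Rightarrow> 'a) \<Rightarrow> ('a fract \<Rightarrow> 's) \<Rightarrow> ('s \<Rightarrow> 'v::ab_group_add \<Rightarrow> 'v) \<Rightarrow> bool"
  where "harish_chandra sA \<iota>L actV \<longleftrightarrow>
    (let M = {m. maximal_ideal m \<and> fin_dim_quotient sA UNIV m} in
      (\<forall>v. \<exists>I u. finite I \<and> I \<subseteq> M \<and> (\<forall>m\<in>I. u m \<in> weight_space \<iota>L actV m) \<and> v = (\<Sum>m\<in>I. u m)) \<and>
      (\<forall>I u. finite I \<and> I \<subseteq> M \<and> (\<forall>m\<in>I. u m \<in> weight_space \<iota>L actV m) \<and> (\<Sum>m\<in>I. u m) = 0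
         \<longrightarrow> (\<forall>m\<in>I. u m = 0)))"


section \<open>Stabilizers\<close>

text \<open>Invertibility in \<open>\<Lambda> \<otimes> \<Lambda> / (\<Lambda> \<otimes> m + m \<otimes> \<Lambda>)\<close>, which is a commutative ring.\<close>

definition invertible_mod :: "('k::field \<Rightarrow> 'a::idom \<Rightarrow> 'a) \<Rightarrow> 'a set \<Rightarrow> (('a \<times> 'a) \<Rightarrow>\<^sub>0 'k) \<Rightarrow> bool"
  where "invertible_mod sA m R \<longleftrightarrow>
    (\<exists>Q. \<exists>p\<in>tensor_sub sA sA UNIV m. \<exists>q\<in>tensor_sub sA sA m UNIV.
      tensor_eq sA sA (tensor_mult R Q) (pure_tensor 1 1 + p + q))"

definition reductor ::
  "('k::field \<Rightarrow> 'a::idom \<Rightarrow> 'a) \<Rightarrow> ('h \<Rightarrow> 'a \<Rightarrow> 'a) \<Rightarrow> 'a set \<Rightarrow> 'h set \<Rightarrow> (('a \<times> 'a) \<Rightarrow>\<^sub>0 'k) \<Rightarrow> bool"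
  where "reductor sA act m C R \<longleftrightarrow>
    invertible_mod sA m R \<and> (\<forall>x\<in>C. bilift sA (\<lambda>r s. r * act x s) R = 0)"

definition superfluous ::
  "('k::field \<Rightarrow> 'h::ring_1 \<Rightarrow> 'h) \<Rightarrow> ('h \<Rightarrow> ('h \<times> 'h) \<Rightarrow>\<^sub>0 'k) \<Rightarrow>
    ('k \<Rightarrow> 'a::idom \<Rightarrow> 'a) \<Rightarrow> ('h \<Rightarrow> 'a \<Rightarrow> 'a) \<Rightarrow> 'a set \<Rightarrow> 'h set \<Rightarrow> bool"
  where "superfluous sH \<Delta> sA act m C \<longleftrightarrow>
    (\<forall>C'. subcoalgebra sH \<Delta> C' \<and> C' \<subseteq> C \<and> fin_dim sH C' \<longrightarrow> (\<exists>R. reductor sA act m C' R))"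

definition superfluous_part ::
  "('k::field \<Rightarrow> 'h::ring_1 \<Rightarrow> 'h) \<Rightarrow> ('h \<Rightarrow> ('h \<times> 'h) \<Rightarrow>\<^sub>0 'k) \<Rightarrow>
    ('k \<Rightarrow> 'a::idom \<Rightarrow> 'a) \<Rightarrow> ('h \<Rightarrow> 'a \<Rightarrow> 'a) \<Rightarrow> 'a set \<Rightarrow> 'h set"
  where "superfluous_part sH \<Delta> sA act m =
    module.span sH (\<Union>{C. subcoalgebra sH \<Delta> C \<and> superfluous sH \<Delta> sA act m C})"

definition superfluous_coideal ::
  "('k::field \<Rightarrow> 'h::ring_1 \<Rightarrow> 'h) \<Rightarrow> ('h \<Rightarrow> ('h \<times> 'h) \<Rightarrow>\<^sub>0 'k) \<Rightarrow>
    ('k \<Rightarrow> 'a::idom \<Rightarrow> 'a) \<Rightarrow> ('h \<Rightarrow> 'a \<Rightarrow> 'a) \<Rightarrow> 'h set \<Rightarrow> 'a set \<Rightarrow> 'h set"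
  where "superfluous_coideal sH \<Delta> sA act C m =
    {x\<in>C. \<Delta> x \<in> tensor_sub sH sH (superfluous_part sH \<Delta> sA act m) C}"

definition fin_dim_Stab ::
  "('k::field \<Rightarrow> 'h::ring_1 \<Rightarrow> 'h) \<Rightarrow> ('h \<Rightarrow> ('h \<times> 'h) \<Rightarrow>\<^sub>0 'k) \<Rightarrow>
    ('k \<Rightarrow> 'a::idom \<Rightarrow> 'a) \<Rightarrow> ('h \<Rightarrow> 'a \<Rightarrow> 'a) \<Rightarrow> 'h set \<Rightarrow> 'a set \<Rightarrow> bool"
  where "fin_dim_Stab sH \<Delta> sA act C m \<longleftrightarrow>
    fin_dim_quotient sH C (superfluous_coideal sH \<Delta> sA act C m)"

end

theory Submission
  imports Defs
begin

text \<open>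
  Let \<open>\<Lambda> \<otimes> \<Lambda>\<close> act on \<open>L # H~\<close> by \<open>(r \<otimes> s) X = r X s\<close> (\<open>biact\<close>).  If \<open>R\<close> is a reductor for a subcoalgebra
  \<open>C'\<close> and \<open>\<Delta> x \<in> C' \<otimes> H\<close>, then \<open>R\<close> kills \<open>L x\<close>.  As \<open>H\<^sub>r\<close> is spanned modulo its superfluous part by
  finitely many elements, whose comultiplications have right factors in a finite set \<open>D \<subseteq> H\<close>, every
  \<open>X \<in> F\<^sub>r\<close> is moved into \<open>F \<inter> L D\<close> by some \<open>R\<close> that is invertible modulo \<open>\<Lambda> \<otimes> m + m \<otimes> \<Lambda>\<close>.
  Let \<open>P\<close> be the projection of \<open>V\<close> onto the weight space of \<open>m\<close>.  On \<open>X \<mapsto> P (X v)\<close> the ideal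
  \<open>\<Lambda> \<otimes> m + m \<otimes> \<Lambda>\<close> acts nilpotently, so \<open>R\<close> acts invertibly and \<open>P (X v)\<close> already lies in
  \<open>P ((F \<inter> L D) v)\<close>.  Finally \<open>F \<inter> L D\<close> is a finitely generated \<open>\<Lambda>\<close>-module: by faithfulness finitely
  many evaluations at elements of \<open>\<Lambda>\<close> separate the points of \<open>L D\<close>, and they take values in \<open>\<Lambda>\<close> on \<open>F\<close>,
  which embeds \<open>F \<inter> L D\<close> into a finite power of the noetherian ring \<open>\<Lambda>\<close>.  So the weight space is finitely
  generated over \<open>\<Lambda>\<close>, and every generator is killed by a power of \<open>m\<close>.
\<close>


section \<open>Formal sums and tensors\<close>

interpretation fsum: vector_space "fsmult :: 'k::field \<Rightarrow> ('b \<Rightarrow>\<^sub>0 'k) \<Rightarrow> _"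
  by (rule vector_space_fsmult)

lemma fsum_expand:
  "p = (\<Sum>z\<in>Poly_Mapping.keys p. fsmult (Poly_Mapping.lookup p z) (pure_tensor (fst z) (snd z)))"
  by (rule poly_mapping_eqI)
     (simp add: lookup_sum pure_tensor_def lookup_single when_def in_keys_iff if_distrib
       sum.delta cong: if_cong)

lemma linear_eq_bilift:
  assumes "Vector_Spaces.linear fsmult sU G"
  shows "G p = bilift sU (\<lambda>a b. G (pure_tensor a b)) p"
proof -
  interpret Vector_Spaces.linear fsmult sU G by fact
  show ?thesis
    by (subst fsum_expand) (simp only: sum scale bilift_def)
qed

text \<open>Formal sums are linear combinations of pure tensors. Identities in \<open>R\<close> and
  \<open>Q\<close> below are reduced to pure tensors this way, one argument at a time.\<close>

lemma linear_eqI_pure_tensor: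
  assumes "Vector_Spaces.linear fsmult sU G" "Vector_Spaces.linear fsmult sU G'"
    and "\<And>a b. G (pure_tensor a b) = G' (pure_tensor a b)"
  shows "G p = G' p"
  unfolding linear_eq_bilift[OF assms(1), of p] linear_eq_bilift[OF assms(2), of p] assms(3) ..

lemma linear_bilift_comp:
  assumes "Vector_Spaces.linear sU sW T"
  shows "T (bilift sU f p) = bilift sW (\<lambda>a b. T (f a b)) p"
proof -
  interpret Vector_Spaces.linear sU sW T by fact
  show ?thesis by (simp add: bilift_def sum scale)
qed

lemma linear_bilift_fun:
  assumes "vector_space sW" "vector_space sU" "\<And>a b. Vector_Spaces.linear sW sU (\<lambda>x. f x a b)"
  shows "Vector_Spaces.linear sW sU (\<lambda>x. bilift sU (f x) p)"
proof -
  interpret U: vector_space sU by fact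
  show ?thesis
    using assms by (simp add: Vector_Spaces.linear_iff bilift_def U.scale_right_distrib sum.distrib
      U.scale_sum_right mult.commute)
qed

lemma bilift_commute:
  assumes "vector_space sU"
  shows "bilift sU (\<lambda>a b. bilift sU (\<lambda>c d. g a b c d) q) p
    = bilift sU (\<lambda>c d. bilift sU (\<lambda>a b. g a b c d) p) q"
proof -
  interpret vector_space sU by fact
  show ?thesis
    unfolding bilift_def scale_sum_right
    by (subst sum.swap) (simp add: mult.commute)
qed

lemma bilift_in_subspace:
  assumes "vector_space sU" "module.subspace sU A"
    and "\<And>a b. (a, b) \<in> Poly_Mapping.keys p \<Longrightarrow> f a b \<in> A"
  shows "bilift sU f p \<in> A"
proof -
  interpret vector_space sU by fact
  show ?thesis
    unfolding bilift_def using assms(3)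
    by (intro subspace_sum[OF assms(2)] subspace_scale[OF assms(2)]) auto
qed

lemma bilift_zero_fun:
  assumes "vector_space sU" and "\<And>a b. (a, b) \<in> Poly_Mapping.keys p \<Longrightarrow> f a b = 0"
  shows "bilift sU f p = 0"
proof -
  interpret vector_space sU by fact
  show ?thesis using bilift_in_subspace[OF assms(1) subspace_single_0] assms(2) by auto
qed

text \<open>The universal property of the tensor product. It allows a representative of
  \<open>\<Delta> x\<close> to be exchanged for one whose entries lie in prescribed
  subspaces.\<close>

lemma tensor_eq_bilift:
  assumes "vector_space sU"
    and "\<And>w. Vector_Spaces.linear sV sU (\<lambda>v. f v w)" "\<And>v. Vector_Spaces.linear sW sU (f v)"
    and "tensor_eq sV sW p q"
  shows "bilift sU f p = bilift sU f q"
proof -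
  interpret Vector_Spaces.linear fsmult sU "bilift sU f" by (rule linear_bilift[OF assms(1)])
  show ?thesis
    using bilift_tensor_null[OF assms(1-3)] assms(4) unfolding tensor_eq_def
    by (metis diff right_minus_eq)
qed

lemma subspace_tensor_null: "module.subspace fsmult (tensor_null sV sW)"
  unfolding tensor_null_def by (rule fsum.subspace_span)

lemma tensor_eq_refl: "tensor_eq sV sW p p"
  by (simp add: tensor_eq_def fsum.subspace_0[OF subspace_tensor_null])

lemma tensor_eq_sym: "tensor_eq sV sW p q \<Longrightarrow> tensor_eq sV sW q p"
  unfolding tensor_eq_def using fsum.subspace_neg[OF subspace_tensor_null] by force

lemma tensor_eq_trans:
  assumes "tensor_eq sV sW p q" "tensor_eq sV sW q u"
  shows "tensor_eq sV sW p u"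
  using fsum.subspace_add[OF subspace_tensor_null] assms unfolding tensor_eq_def by force

lemma tensor_eq_add:
  assumes "tensor_eq sV sW p q" "tensor_eq sV sW p' q'"
  shows "tensor_eq sV sW (p + p') (q + q')"
  using fsum.subspace_add[OF subspace_tensor_null] assms unfolding tensor_eq_def
  by (metis add_diff_add)

lemma tensor_eq_fsmult:
  assumes "tensor_eq sV sW p q"
  shows "tensor_eq sV sW (fsmult c p) (fsmult c q)"
  using fsum.subspace_scale[OF subspace_tensor_null] assms unfolding tensor_eq_def
  by (metis fsum.scale_right_diff_distrib)

lemma tensor_eq_sum:
  assumes "\<And>i. i \<in> I \<Longrightarrow> tensor_eq sV sW (f i) (g i)"
  shows "tensor_eq sV sW (sum f I) (sum g I)"
  using assms unfolding tensor_eq_def sum_subtractf[symmetric]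
  by (intro fsum.subspace_sum[OF subspace_tensor_null])

lemma tensor_null_generators:
  "pure_tensor (v + v') w - pure_tensor v w - pure_tensor v' w \<in> tensor_null sV sW"
  "pure_tensor v (w + w') - pure_tensor v w - pure_tensor v w' \<in> tensor_null sV sW"
  "pure_tensor (sV c v) w - fsmult c (pure_tensor v w) \<in> tensor_null sV sW"
  "pure_tensor v (sW c w) - fsmult c (pure_tensor v w) \<in> tensor_null sV sW"
  unfolding tensor_null_def by (rule fsum.span_base; blast)+

lemma tensor_eq_pure:
  "tensor_eq sV sW (pure_tensor (v + v') w) (pure_tensor v w + pure_tensor v' w)"
  "tensor_eq sV sW (pure_tensor v (w + w')) (pure_tensor v w + pure_tensor v w')"
  "tensor_eq sV sW (pure_tensor (sV c v) w) (fsmult c (pure_tensor v w))"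
  "tensor_eq sV sW (pure_tensor v (sW c w)) (fsmult c (pure_tensor v w))"
  using tensor_null_generators unfolding tensor_eq_def diff_diff_eq by metis+

lemma tensor_eq_pure_sum_left:
  assumes "vector_space sV"
  shows "tensor_eq sV sW (pure_tensor (\<Sum>i\<in>I. sV (c i) (v i)) w) (\<Sum>i\<in>I. fsmult (c i) (pure_tensor (v i) w))"
proof -
  interpret vector_space sV by fact
  \<comment> \<open>A pure tensor with a zero factor is not the zero formal sum; it is null because
    the zero can be pulled out as a scalar.\<close>
  have "tensor_eq sV sW (pure_tensor 0 w) 0"
    using tensor_eq_pure(3)[of sV sW 0 0 w] by simp
  then show ?thesis
    by (induction I rule: infinite_finite_induct)
       (auto intro: tensor_eq_trans[OF tensor_eq_pure(1)] tensor_eq_add tensor_eq_pure)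
qed

lemma tensor_eq_pure_sum_right:
  assumes "vector_space sW"
  shows "tensor_eq sV sW (pure_tensor v (\<Sum>i\<in>I. sW (c i) (w i))) (\<Sum>i\<in>I. fsmult (c i) (pure_tensor v (w i)))"
proof -
  interpret vector_space sW by fact
  have "tensor_eq sV sW (pure_tensor v 0) 0"
    using tensor_eq_pure(4)[of sV sW v 0 0] by simp
  then show ?thesis
    by (induction I rule: infinite_finite_induct)
       (auto intro: tensor_eq_trans[OF tensor_eq_pure(2)] tensor_eq_add tensor_eq_pure)
qed

lemma bilift_pure_tensor: "bilift fsmult pure_tensor p = p"
  unfolding bilift_def by (rule fsum_expand[symmetric])

lemma tensor_eq_bilift_fun:
  assumes "\<And>a b. (a, b) \<in> Poly_Mapping.keys p \<Longrightarrow> tensor_eq sV sW (f a b) (g a b)"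
  shows "tensor_eq sV sW (bilift fsmult f p) (bilift fsmult g p)"
  unfolding bilift_def using assms by (intro tensor_eq_sum tensor_eq_fsmult) auto

section \<open>The product on formal sums\<close>

lemma tensor_mult_pure:
  "tensor_mult (pure_tensor a b) (pure_tensor c d) = pure_tensor (a * c) (b * d)"
  by (simp add: tensor_mult_def vector_space_fsmult)

lemma linear_tensor_mult_left: "Vector_Spaces.linear fsmult fsmult (\<lambda>p. tensor_mult p q)"
  unfolding tensor_mult_def by (rule linear_bilift[OF vector_space_fsmult])

lemma linear_tensor_mult_right: "Vector_Spaces.linear fsmult fsmult (tensor_mult p)"
  unfolding tensor_mult_def
  by (intro linear_bilift_fun linear_bilift vector_space_fsmult)

lemma tensor_mult_commute:
  fixes p q :: "('a::ab_semigroup_mult \<times> 'b::ab_semigroup_mult) \<Rightarrow>\<^sub>0 'k::field"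
  shows "tensor_mult p q = tensor_mult q p"
  unfolding tensor_mult_def
  by (subst bilift_commute[OF vector_space_fsmult]) (simp add: mult.commute)

lemma linear_compose_fun:
  assumes "Vector_Spaces.linear s2 s3 g" "Vector_Spaces.linear s1 s2 f"
  shows "Vector_Spaces.linear s1 s3 (\<lambda>x. g (f x))"
  using assms unfolding Vector_Spaces.linear_iff by auto

lemma tensor_mult_assoc:
  fixes p q u :: "('a::semigroup_mult \<times> 'b::semigroup_mult) \<Rightarrow>\<^sub>0 'k::field"
  shows "tensor_mult (tensor_mult p q) u = tensor_mult p (tensor_mult q u)"
proof (rule linear_eqI_pure_tensor[of fsmult _ _ p])
  note lin = linear_tensor_mult_left linear_tensor_mult_right
  show "Vector_Spaces.linear fsmult fsmult (\<lambda>p. tensor_mult (tensor_mult p q) u)"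
    by (intro linear_compose_fun[OF lin(1) lin(1)])
  show "Vector_Spaces.linear fsmult fsmult (\<lambda>p. tensor_mult p (tensor_mult q u))"
    by (rule lin)
  fix a :: 'a and b :: 'b
  show "tensor_mult (tensor_mult (pure_tensor a b) q) u
      = tensor_mult (pure_tensor a b) (tensor_mult q u)"
  proof (rule linear_eqI_pure_tensor[of fsmult _ _ q])
    show "Vector_Spaces.linear fsmult fsmult (\<lambda>q. tensor_mult (tensor_mult (pure_tensor a b) q) u)"
      by (intro linear_compose_fun[OF lin(1) lin(2)])
    show "Vector_Spaces.linear fsmult fsmult (\<lambda>q. tensor_mult (pure_tensor a b) (tensor_mult q u))"
      by (intro linear_compose_fun[OF lin(2) lin(1)])
    fix c :: 'a and d :: 'b
    show "tensor_mult (tensor_mult (pure_tensor a b) (pure_tensor c d)) u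
        = tensor_mult (pure_tensor a b) (tensor_mult (pure_tensor c d) u)"
    proof (rule linear_eqI_pure_tensor[of fsmult _ _ u])
      show "Vector_Spaces.linear fsmult fsmult (\<lambda>u. tensor_mult (pure_tensor a b) (tensor_mult (pure_tensor c d) u))"
        by (intro linear_compose_fun[OF lin(2) lin(2)])
    qed (simp_all add: lin tensor_mult_pure mult.assoc)
  qed
qed

lemma tensor_mult_one_left:
  fixes p :: "('a::monoid_mult \<times> 'b::monoid_mult) \<Rightarrow>\<^sub>0 'k::field"
  shows "tensor_mult (pure_tensor 1 1) p = p"
  by (simp add: tensor_mult_def bilift_pure[OF vector_space_fsmult] bilift_pure_tensor)

lemma keys_pure_tensor: "Poly_Mapping.keys (pure_tensor a b :: _ \<Rightarrow>\<^sub>0 'k::field) = {(a, b)}"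
  by (simp add: pure_tensor_def)

lemma keys_bilift:
  "Poly_Mapping.keys (bilift fsmult f p) \<subseteq> (\<Union>(a, b)\<in>Poly_Mapping.keys p. Poly_Mapping.keys (f a b))"
proof -
  have "Poly_Mapping.keys (bilift fsmult f p) \<subseteq> (\<Union>z\<in>Poly_Mapping.keys p.
      Poly_Mapping.keys (fsmult (Poly_Mapping.lookup p z) (f (fst z) (snd z))))"
    unfolding bilift_def by (rule keys_sum)
  also have "\<dots> \<subseteq> (\<Union>(a, b)\<in>Poly_Mapping.keys p. Poly_Mapping.keys (f a b))"
    by (force simp: in_keys_iff)
  finally show ?thesis .
qed

lemma keys_tensor_mult:
  assumes "z \<in> Poly_Mapping.keys (tensor_mult p q)"
  obtains a b c d where "(a, b) \<in> Poly_Mapping.keys p" "(c, d) \<in> Poly_Mapping.keys q" "z = (a * c, b * d)"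
  using assms unfolding tensor_mult_def
  by (fastforce dest!: subsetD[OF keys_bilift] simp: keys_pure_tensor)

text \<open>A pure tensor times a bilinearity relation is a relation of the same family, so
  \<open>tensor_null\<close> is stable under multiplication by pure tensors and hence by all formal
  sums.\<close>

lemma tensor_eq_tensor_mult_right:
  assumes "k_algebra sV" "k_algebra sW" "tensor_eq sV sW q q'"
  shows "tensor_eq sV sW (tensor_mult p q) (tensor_mult p q')"
proof -
  interpret V: k_algebra sV by fact
  interpret W: k_algebra sW by fact
  interpret M: Vector_Spaces.linear fsmult fsmult "tensor_mult p" by (rule linear_tensor_mult_right)
  have "tensor_mult (pure_tensor a b) x \<in> tensor_null sV sW" if "x \<in> tensor_null sV sW" for x a b
  proof -
    interpret P: Vector_Spaces.linear fsmult fsmult "tensor_mult (pure_tensor a b)"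
      by (rule linear_tensor_mult_right)
    let ?N = "tensor_null sV sW"
    have "module.subspace fsmult (tensor_mult (pure_tensor a b) -` ?N)"
      by (rule P.subspace_vimage[OF subspace_tensor_null])
    moreover have "\<And>v v' w. tensor_mult (pure_tensor a b) (pure_tensor (v + v') w - pure_tensor v w - pure_tensor v' w) \<in> ?N"
      "\<And>v w w'. tensor_mult (pure_tensor a b) (pure_tensor v (w + w') - pure_tensor v w - pure_tensor v w') \<in> ?N"
      "\<And>c v w. tensor_mult (pure_tensor a b) (pure_tensor (sV c v) w - fsmult c (pure_tensor v w)) \<in> ?N"
      "\<And>c v w. tensor_mult (pure_tensor a b) (pure_tensor v (sW c w) - fsmult c (pure_tensor v w)) \<in> ?N"
      unfolding P.diff P.scale tensor_mult_pure distrib_left V.scale_mult_right W.scale_mult_right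
      by (rule tensor_null_generators)+
    ultimately have "?N \<subseteq> tensor_mult (pure_tensor a b) -` ?N"
      by (subst (1) tensor_null_def, intro fsum.span_minimal) auto
    then show ?thesis using that by blast
  qed
  then have "tensor_mult p x \<in> tensor_null sV sW" if "x \<in> tensor_null sV sW" for x
    using that unfolding linear_eq_bilift[OF linear_tensor_mult_left, of p]
    by (intro bilift_in_subspace[OF vector_space_fsmult subspace_tensor_null])
  then show ?thesis
    using assms(3) unfolding tensor_eq_def by (metis M.diff)
qed

lemma tensor_eq_tensor_mult:
  fixes sV :: "'k::field \<Rightarrow> 'a::comm_ring_1 \<Rightarrow> 'a" and sW :: "'k \<Rightarrow> 'b::comm_ring_1 \<Rightarrow> 'b"
  assumes "k_algebra sV" "k_algebra sW" "tensor_eq sV sW p p'" "tensor_eq sV sW q q'"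
  shows "tensor_eq sV sW (tensor_mult p q) (tensor_mult p' q')"
  using tensor_eq_tensor_mult_right[OF assms(1,2)] assms(3,4)
  by (metis tensor_eq_trans tensor_mult_commute)

section \<open>Invertibility modulo
  \<open>\<Lambda> \<otimes> m + m \<otimes> \<Lambda>\<close>\<close>

lemma maximal_ideal_mult: "maximal_ideal m \<Longrightarrow> a \<in> m \<Longrightarrow> b * a \<in> m"
proof -
  interpret module "(*) :: 'a::comm_ring_1 \<Rightarrow> _" by unfold_locales (auto simp: algebra_simps)
  show "maximal_ideal m \<Longrightarrow> a \<in> m \<Longrightarrow> b * a \<in> m" for a b :: 'a
    unfolding maximal_ideal_def ideal_def by (auto dest: subspace_scale)
qed

text \<open>Absorbing the equivalences of the error terms into the one equation leaves
  \<open>p\<close> and \<open>q\<close> with entries literally in \<open>m\<close>, so that later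
  arguments can inspect them key by key.\<close>

lemma invertible_modE:
  assumes "invertible_mod sA m R"
  obtains Q p q where "Poly_Mapping.keys p \<subseteq> UNIV \<times> m" "Poly_Mapping.keys q \<subseteq> m \<times> UNIV"
    "tensor_eq sA sA (tensor_mult R Q) (pure_tensor 1 1 + (p + q))"
proof -
  from assms obtain Q p p' q q' where
    *: "tensor_eq sA sA (tensor_mult R Q) (pure_tensor 1 1 + p + q)"
    "tensor_eq sA sA p p'" "Poly_Mapping.keys p' \<subseteq> UNIV \<times> m"
    "tensor_eq sA sA q q'" "Poly_Mapping.keys q' \<subseteq> m \<times> UNIV"
    unfolding invertible_mod_def tensor_sub_def by blast
  have "tensor_eq sA sA (pure_tensor 1 1 + p + q) (pure_tensor 1 1 + (p' + q'))"
    unfolding add.assoc by (intro tensor_eq_add tensor_eq_refl *)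
  with * show ?thesis by (blast intro: that tensor_eq_trans)
qed

lemma invertible_modI:
  assumes "Poly_Mapping.keys p \<subseteq> UNIV \<times> m" "Poly_Mapping.keys q \<subseteq> m \<times> UNIV"
    "tensor_eq sA sA (tensor_mult R Q) (pure_tensor 1 1 + (p + q))"
  shows "invertible_mod sA m R"
  using assms unfolding invertible_mod_def tensor_sub_def add.assoc[symmetric]
  by (blast intro: tensor_eq_refl)

text \<open>The product of the two inverses works: with \<open>w = 1 + p' + q'\<close> one has
  \<open>(1 + p + q) w = 1 + (p' + p w) + (q' + q w)\<close>, and both brackets keep their entries
  in \<open>m\<close> because \<open>m\<close> absorbs products.\<close>

lemma invertible_mod_mult:
  fixes sA :: "'k::field \<Rightarrow> 'a::idom \<Rightarrow> 'a"
  assumes A: "k_algebra sA" and m: "\<And>a b. a \<in> m \<Longrightarrow> a * b \<in> m"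
    and R: "invertible_mod sA m R" "invertible_mod sA m R'"
  shows "invertible_mod sA m (tensor_mult R R')"
proof -
  obtain Q p q where 1: "Poly_Mapping.keys p \<subseteq> UNIV \<times> m" "Poly_Mapping.keys q \<subseteq> m \<times> UNIV"
    "tensor_eq sA sA (tensor_mult R Q) (pure_tensor 1 1 + (p + q))"
    using invertible_modE[OF R(1)] .
  obtain Q' p' q' where 2: "Poly_Mapping.keys p' \<subseteq> UNIV \<times> m" "Poly_Mapping.keys q' \<subseteq> m \<times> UNIV"
    "tensor_eq sA sA (tensor_mult R' Q') (pure_tensor 1 1 + (p' + q'))"
    using invertible_modE[OF R(2)] .
  let ?w = "pure_tensor 1 1 + (p' + q')"
  have "tensor_eq sA sA (tensor_mult (tensor_mult R Q) (tensor_mult R' Q'))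
      (tensor_mult (pure_tensor 1 1 + (p + q)) ?w)"
    by (rule tensor_eq_tensor_mult[OF A A 1(3) 2(3)])
  also have "tensor_mult (tensor_mult R Q) (tensor_mult R' Q')
      = tensor_mult (tensor_mult R R') (tensor_mult Q Q')"
    by (metis tensor_mult_assoc tensor_mult_commute)
  also have "tensor_mult (pure_tensor 1 1 + (p + q)) ?w
      = pure_tensor 1 1 + ((p' + tensor_mult p ?w) + (q' + tensor_mult q ?w))"
    using linear_tensor_mult_left[of ?w] by (simp add: Vector_Spaces.linear_iff tensor_mult_one_left add_ac)
  finally show ?thesis
  proof (rule invertible_modI[rotated 2])
    show "Poly_Mapping.keys (p' + tensor_mult p ?w) \<subseteq> UNIV \<times> m"
      using 1 2 m by (intro order.trans[OF keys_add]) (auto elim!: keys_tensor_mult)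
    show "Poly_Mapping.keys (q' + tensor_mult q ?w) \<subseteq> m \<times> UNIV"
      using 1 2 m by (intro order.trans[OF keys_add]) (auto elim!: keys_tensor_mult)
  qed
qed


section \<open>Slices and finite-dimensional subcoalgebras\<close>

lemma vector_space_field: "vector_space ((*) :: 'k::field \<Rightarrow> 'k \<Rightarrow> 'k)"
  by unfold_locales (auto simp: algebra_simps)

lemma linear_subspace_vimage:
  assumes "Vector_Spaces.linear sV sW f" "module.subspace sW A"
  shows "module.subspace sV (f -` A)"
proof -
  interpret Vector_Spaces.linear sV sW f by fact
  show ?thesis by (rule subspace_vimage[OF assms(2)])
qed

lemma separating_functional:
  assumes "vector_space sV" "v \<noteq> 0"
  obtains g where "Vector_Spaces.linear sV (*) g" "g v \<noteq> 0"
proof -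
  interpret vector_space_pair sV "(*)"
    using assms(1) vector_space_field by (rule vector_space_pair.intro)
  have "vs1.independent {v}" using assms(2) by simp
  from linear_independent_extend[OF this, of "\<lambda>_. 1"] show ?thesis
    by (auto intro: that)
qed

text \<open>Expanding the first factors in a basis \<open>BV\<close> that extends a basis
  \<open>BA\<close> of \<open>A\<close> turns \<open>p\<close> into a sum of tensors
  \<open>b \<otimes> w b\<close>, where \<open>w b\<close> is the slice along coordinate
  \<open>b\<close>. By \<open>l\<close>, every \<open>w b\<close> lies in \<open>B\<close>. For
  \<open>b\<close> outside \<open>BA\<close>, a functional \<open>g\<close> maps \<open>w b\<close>
  to coordinate \<open>b\<close> of a slice that lies in \<open>A\<close> by \<open>r\<close>; this
  is zero, and since functionals separate points, \<open>w b = 0\<close>.\<close>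

lemma tensor_sub_slicesI:
  assumes V: "vector_space sV" and W: "vector_space sW"
    and A: "module.subspace sV A" and B: "module.subspace sW B"
    and l: "\<And>f. Vector_Spaces.linear sV (*) f \<Longrightarrow> bilift sW (\<lambda>v w. sW (f v) w) p \<in> B"
    and r: "\<And>g. Vector_Spaces.linear sW (*) g \<Longrightarrow> bilift sV (\<lambda>v w. sV (g w) v) p \<in> A"
  shows "p \<in> tensor_sub sV sW A B"
proof -
  interpret V: vector_space sV by fact
  interpret W: vector_space sW by fact
  obtain BA where BA: "BA \<subseteq> A" "V.independent BA" "A \<subseteq> V.span BA"
    using V.maximal_independent_subset[of A] by metis
  define BV where "BV = V.extend_basis BA"
  have BV: "V.independent BV" "V.span BV = UNIV" "BA \<subseteq> BV"
    unfolding BV_def using BA(2) V.independent_extend_basis V.span_extend_basis V.extend_basis_superset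
    by auto
  define c where "c b v = V.representation BV v b" for b v
  have c: "Vector_Spaces.linear sV (*) (c b)" for b
    unfolding Vector_Spaces.linear_iff c_def
    using BV V vector_space_field by (simp add: V.representation_add V.representation_scale)
  define w where "w b = bilift sW (\<lambda>v w. sW (c b v) w) p" for b
  have w_B: "w b \<in> B" for b
    unfolding w_def by (rule l[OF c])
  have w_0: "w b = 0" if "b \<notin> BA" for b
  proof (rule ccontr)
    assume "w b \<noteq> 0"
    from separating_functional[OF W this] obtain g
      where g: "Vector_Spaces.linear sW (*) g" "g (w b) \<noteq> 0" .
    have "g (w b) = bilift (*) (\<lambda>v w. c b v * g w) p"
      unfolding w_def linear_bilift_comp[OF g(1)] using g(1) by (simp add: Vector_Spaces.linear_iff)
    also have "\<dots> = c b (bilift sV (\<lambda>v w. sV (g w) v) p)"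
      unfolding linear_bilift_comp[OF c] using c by (simp add: Vector_Spaces.linear_iff mult.commute)
    also have "\<dots> = V.representation BA (bilift sV (\<lambda>v w. sV (g w) v) p) b"
      unfolding c_def using r[OF g(1)] BA BV by (subst V.representation_extend[OF BV(1) _ BV(3)]) auto
    also have "\<dots> = 0" using that V.representation_ne_zero by blast
    finally show False using g(2) by simp
  qed
  \<comment> \<open>Only finitely many basis vectors occur in the first entries of \<open>p\<close>,
    so one finite index set serves all expansions.\<close>
  define K where "K = (\<Union>z\<in>Poly_Mapping.keys p. {b. c b (fst z) \<noteq> 0})"
  have K: "finite K" unfolding K_def c_def by (auto intro: V.finite_representation)
  have expand: "v = (\<Sum>b\<in>K. sV (c b v) b)" if "(v, u) \<in> Poly_Mapping.keys p" for v u
  proof -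
    have "v = (\<Sum>b | c b v \<noteq> 0. sV (c b v) b)"
      unfolding c_def using V.sum_nonzero_representation_eq[OF BV(1)] BV(2) by auto
    also have "\<dots> = (\<Sum>b\<in>K. sV (c b v) b)"
      using that K by (intro sum.mono_neutral_left) (auto simp: K_def)
    finally show ?thesis .
  qed
  have "tensor_eq sV sW (bilift fsmult pure_tensor p)
      (bilift fsmult (\<lambda>v u. \<Sum>b\<in>K. fsmult (c b v) (pure_tensor b u)) p)"
  proof (rule tensor_eq_bilift_fun)
    fix v u assume "(v, u) \<in> Poly_Mapping.keys p"
    from expand[OF this, symmetric]
    show "tensor_eq sV sW (pure_tensor v u) (\<Sum>b\<in>K. fsmult (c b v) (pure_tensor b u))"
      using tensor_eq_pure_sum_left[OF V, of sW "\<lambda>b. c b v" "\<lambda>b. b" K u] by simp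
  qed
  also have "bilift fsmult (\<lambda>v u. \<Sum>b\<in>K. fsmult (c b v) (pure_tensor b u)) p
      = (\<Sum>b\<in>K. bilift fsmult (\<lambda>v u. fsmult (c b v) (pure_tensor b u)) p)"
    unfolding bilift_def fsum.scale_sum_right by (rule sum.swap)
  finally have "tensor_eq sV sW p (\<Sum>b\<in>K. bilift fsmult (\<lambda>v u. fsmult (c b v) (pure_tensor b u)) p)"
    by (simp add: bilift_pure_tensor)
  moreover have "tensor_eq sV sW (bilift fsmult (\<lambda>v u. fsmult (c b v) (pure_tensor b u)) p)
      (pure_tensor b (w b))" for b
  proof -
    have "w b = (\<Sum>z\<in>Poly_Mapping.keys p. sW (Poly_Mapping.lookup p z * c b (fst z)) (snd z))"
      unfolding w_def bilift_def by simp
    then have "tensor_eq sV sW (pure_tensor b (w b))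
        (\<Sum>z\<in>Poly_Mapping.keys p. fsmult (Poly_Mapping.lookup p z * c b (fst z)) (pure_tensor b (snd z)))"
      using tensor_eq_pure_sum_right[OF W, of sV b "\<lambda>z. Poly_Mapping.lookup p z * c b (fst z)" snd "Poly_Mapping.keys p"]
      by simp
    then show ?thesis
      unfolding bilift_def by (auto intro: tensor_eq_sym)
  qed
  ultimately have "tensor_eq sV sW p (\<Sum>b\<in>K. pure_tensor b (w b))"
    by (rule tensor_eq_trans[OF _ tensor_eq_sum])
  also have "(\<Sum>b\<in>K. pure_tensor b (w b)) =
    (\<Sum>b\<in>K \<inter> BA. pure_tensor b (w b)) + (\<Sum>b\<in>K - BA. pure_tensor b (w b) :: _ \<Rightarrow>\<^sub>0 'a)"
    by (rule sum.Int_Diff[OF K])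
  finally have "tensor_eq sV sW p \<dots>" .
  moreover have "tensor_eq sV sW (\<Sum>b\<in>K - BA. pure_tensor b (w b)) (\<Sum>b\<in>K - BA. 0)"
  proof (rule tensor_eq_sum)
    fix b assume "b \<in> K - BA"
    then show "tensor_eq sV sW (pure_tensor b (w b)) 0"
      using tensor_eq_pure(4)[of sV sW b 0 0] w_0[of b] by simp
  qed
  ultimately have "tensor_eq sV sW p ((\<Sum>b\<in>K \<inter> BA. pure_tensor b (w b)) + (\<Sum>b\<in>K - BA. 0))"
    by (rule tensor_eq_trans[OF _ tensor_eq_add[OF tensor_eq_refl]])
  moreover have "Poly_Mapping.keys (\<Sum>b\<in>K \<inter> BA. pure_tensor b (w b) :: _ \<Rightarrow>\<^sub>0 'a) \<subseteq> A \<times> B"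
    using BA(1) w_B by (intro order.trans[OF keys_sum]) (auto simp: keys_pure_tensor)
  ultimately show ?thesis
    unfolding tensor_sub_def by auto
qed

text \<open>A triple is a nested pair, so \<open>bilift\<close> also extends trilinear maps; each
  spanning relation dies by linearity in one argument.\<close>

lemma tensor_null3_bilift:
  assumes U: "vector_space sU"
    and 1: "\<And>v w. Vector_Spaces.linear s sU (\<lambda>u. g u v w)"
    and 2: "\<And>u w. Vector_Spaces.linear s sU (\<lambda>v. g u v w)"
    and 3: "\<And>u v. Vector_Spaces.linear s sU (g u v)"
    and p: "p \<in> tensor_null3 s"
  shows "bilift sU (\<lambda>u vw. g u (fst vw) (snd vw)) p = 0"
proof -
  let ?G = "bilift sU (\<lambda>u vw. g u (fst vw) (snd vw))"
  interpret G: Vector_Spaces.linear fsmult sU ?G by (rule linear_bilift[OF U])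
  have pure: "?G (pure_tensor3 u v w) = g u v w" for u v w
    using bilift_pure[OF U, of "\<lambda>u vw. g u (fst vw) (snd vw)" u "(v, w)"]
    by (simp add: pure_tensor_def pure_tensor3_def)
  show ?thesis
    using 1 2 3
    by (intro G.eq_0_on_span[OF _ p[unfolded tensor_null3_def]])
       (auto simp: G.diff G.scale pure Vector_Spaces.linear_iff)
qed

section \<open>Slices of the comultiplication by linear functionals\<close>

context hopf_algebra
begin

text \<open>\<open>\<Delta>\<close> is linear only up to \<open>tensor_eq\<close>; applying a
  bilinear map removes the ambiguity.\<close>

lemma bilift_comult_linear:
  assumes "vector_space sU"
    and "\<And>w. Vector_Spaces.linear sH sU (\<lambda>v. f v w)" "\<And>v. Vector_Spaces.linear sH sU (f v)"
  shows "Vector_Spaces.linear sH sU (\<lambda>x. bilift sU f (\<Delta> x))"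
  unfolding Vector_Spaces.linear_iff
  using tensor_eq_bilift[OF assms comult_add] tensor_eq_bilift[OF assms comult_scale]
    bilift_add[OF assms(1)] bilift_fsmult[OF assms(1)] assms(1) vector_space_axioms
  by metis

lemma coassoc_trilinear:
  assumes U: "vector_space sU"
    and g: "\<And>v w. Vector_Spaces.linear sH sU (\<lambda>u. g u v w)"
      "\<And>u w. Vector_Spaces.linear sH sU (\<lambda>v. g u v w)"
      "\<And>u v. Vector_Spaces.linear sH sU (g u v)"
  shows "bilift sU (\<lambda>a b. bilift sU (\<lambda>c d. g c d b) (\<Delta> a)) (\<Delta> x)
    = bilift sU (\<lambda>a b. bilift sU (\<lambda>c d. g a c d) (\<Delta> b)) (\<Delta> x)"
proof -
  let ?G = "bilift sU (\<lambda>u vw. g u (fst vw) (snd vw))"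
  have lin: "Vector_Spaces.linear fsmult sU ?G" by (rule linear_bilift[OF U])
  have pure: "?G (pure_tensor3 u v w) = g u v w" for u v w
    using bilift_pure[OF U, of "\<lambda>u vw. g u (fst vw) (snd vw)" u "(v, w)"]
    by (simp add: pure_tensor_def pure_tensor3_def)
  interpret G: Vector_Spaces.linear fsmult sU ?G by (rule lin)
  from tensor_null3_bilift[OF U g coassoc[of x]]
  show ?thesis
    unfolding G.diff linear_bilift_comp[OF lin] pure right_minus_eq .
qed

text \<open>Slices are the two hit actions of the dual algebra on the Hopf algebra. For linear
  \<open>f\<close> they do not depend on the representative chosen for
  \<open>\<Delta> x\<close>.\<close>

definition slice_left :: "('h \<Rightarrow> 'k) \<Rightarrow> 'h \<Rightarrow> 'h"
  where "slice_left f x = bilift sH (\<lambda>a b. sH (f a) b) (\<Delta> x)"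

definition slice_right :: "('h \<Rightarrow> 'k) \<Rightarrow> 'h \<Rightarrow> 'h"
  where "slice_right f x = bilift sH (\<lambda>a b. sH (f b) a) (\<Delta> x)"

abbreviation "functional \<equiv> Vector_Spaces.linear sH (*)"

lemma functionalD:
  assumes "functional f"
  shows "f (x + y) = f x + f y" "f (sH c x) = c * f x"
  using assms by (auto simp: Vector_Spaces.linear_iff)

lemmas slice_linear_simps = Vector_Spaces.linear_iff vector_space_axioms vector_space_field
  scale_left_distrib scale_right_distrib algebra_simps

lemma linear_slice:
  assumes "functional f"
  shows "Vector_Spaces.linear sH sH (slice_left f)" "Vector_Spaces.linear sH sH (slice_right f)"
  unfolding slice_left_def[abs_def] slice_right_def[abs_def]
  by (intro bilift_comult_linear vector_space_axioms;
      simp add: slice_linear_simps functionalD[OF assms])+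

lemma functional_convolution:
  assumes "functional f" "functional g"
  shows "functional (\<lambda>x. bilift (*) (\<lambda>a b. f a * g b) (\<Delta> x))"
  by (intro bilift_comult_linear vector_space_field;
      simp add: slice_linear_simps functionalD[OF assms(1)] functionalD[OF assms(2)])

text \<open>By coassociativity both sides evaluate \<open>g\<close> on the first and
  \<open>f\<close> on the second leg of the iterated comultiplication and keep the third. The inner
  slice acts first, hence the order in the convolution.\<close>

lemma slice_left_slice_left:
  assumes f: "functional f" and g: "functional g"
  shows "slice_left f (slice_left g x) = slice_left (\<lambda>y. bilift (*) (\<lambda>a b. g a * f b) (\<Delta> y)) x"
proof -
  note lin = linear_slice(1)[OF f]
  have "slice_left f (slice_left g x) = bilift sH (\<lambda>a b. sH (g a) (slice_left f b)) (\<Delta> x)"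
    using lin by (simp add: slice_left_def[of g] linear_bilift_comp[OF lin] Vector_Spaces.linear_iff)
  also have "\<dots> = bilift sH (\<lambda>a b. bilift sH (\<lambda>c d. sH (g a * f c) d) (\<Delta> b)) (\<Delta> x)"
    by (simp add: slice_left_def linear_bilift_comp[OF linear_scale_self])
  also have "\<dots> = bilift sH (\<lambda>a b. bilift sH (\<lambda>c d. sH (g c * f d) b) (\<Delta> a)) (\<Delta> x)"
    by (rule coassoc_trilinear[symmetric, OF vector_space_axioms])
       (simp_all add: slice_linear_simps functionalD[OF f] functionalD[OF g])
  also have "\<dots> = slice_left (\<lambda>y. bilift (*) (\<lambda>a b. g a * f b) (\<Delta> y)) x"
  proof -
    have "Vector_Spaces.linear (*) sH (\<lambda>c. sH c b)" for b
      by (simp add: slice_linear_simps)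
    from linear_bilift_comp[OF this, of _ "\<Delta> _"] show ?thesis by (simp add: slice_left_def)
  qed
  finally show ?thesis .
qed

lemma slice_right_slice_right:
  assumes f: "functional f" and g: "functional g"
  shows "slice_right f (slice_right g x) = slice_right (\<lambda>y. bilift (*) (\<lambda>a b. f a * g b) (\<Delta> y)) x"
proof -
  note lin = linear_slice(2)[OF f]
  have "slice_right f (slice_right g x) = bilift sH (\<lambda>a b. sH (g b) (slice_right f a)) (\<Delta> x)"
    using lin by (simp add: slice_right_def[of g] linear_bilift_comp[OF lin] Vector_Spaces.linear_iff)
  also have "\<dots> = bilift sH (\<lambda>a b. bilift sH (\<lambda>c d. sH (f d * g b) c) (\<Delta> a)) (\<Delta> x)"
    by (simp add: slice_right_def linear_bilift_comp[OF linear_scale_self] mult.commute)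
  also have "\<dots> = bilift sH (\<lambda>a b. bilift sH (\<lambda>c d. sH (f c * g d) a) (\<Delta> b)) (\<Delta> x)"
    by (rule coassoc_trilinear[OF vector_space_axioms])
       (simp_all add: slice_linear_simps functionalD[OF f] functionalD[OF g])
  also have "\<dots> = slice_right (\<lambda>y. bilift (*) (\<lambda>a b. f a * g b) (\<Delta> y)) x"
  proof -
    have "Vector_Spaces.linear (*) sH (\<lambda>c. sH c b)" for b
      by (simp add: slice_linear_simps)
    from linear_bilift_comp[OF this, of _ "\<Delta> _"] show ?thesis by (simp add: slice_right_def)
  qed
  finally show ?thesis .
qed

text \<open>The two slices consume opposite outer legs of the iterated comultiplication and keep the
  middle one.\<close>

lemma slice_right_slice_left:
  assumes f: "functional f" and g: "functional g"
  shows "slice_right f (slice_left g x) = slice_left g (slice_right f x)"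
proof -
  note lin = linear_slice(2)[OF f] linear_slice(1)[OF g]
  have "slice_right f (slice_left g x) = bilift sH (\<lambda>a b. sH (g a) (slice_right f b)) (\<Delta> x)"
    using lin by (simp add: slice_left_def[of g x] linear_bilift_comp[OF lin(1)] Vector_Spaces.linear_iff)
  also have "\<dots> = bilift sH (\<lambda>a b. bilift sH (\<lambda>c d. sH (g a * f d) c) (\<Delta> b)) (\<Delta> x)"
    by (simp add: slice_right_def linear_bilift_comp[OF linear_scale_self])
  also have "\<dots> = bilift sH (\<lambda>a b. bilift sH (\<lambda>c d. sH (g c * f b) d) (\<Delta> a)) (\<Delta> x)"
    by (rule coassoc_trilinear[symmetric, OF vector_space_axioms])
       (simp_all add: slice_linear_simps functionalD[OF f] functionalD[OF g])
  also have "\<dots> = bilift sH (\<lambda>a b. sH (f b) (slice_left g a)) (\<Delta> x)"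
    by (simp add: slice_left_def linear_bilift_comp[OF linear_scale_self] mult.commute)
  also have "\<dots> = slice_left g (slice_right f x)"
    using lin by (simp add: slice_right_def linear_bilift_comp[OF lin(2)] Vector_Spaces.linear_iff)
  finally show ?thesis .
qed

lemma functional_counit: "functional \<epsilon>"
  using counit_hom by (simp add: algebra_hom_def)

lemma slice_counit [simp]: "slice_left \<epsilon> x = x" "slice_right \<epsilon> x = x"
  by (simp_all add: slice_left_def slice_right_def counit_left counit_right)

lemma slice_subcoalgebra:
  assumes C: "subcoalgebra sH \<Delta> C" and f: "functional f" and x: "x \<in> C"
  shows "slice_left f x \<in> C" "slice_right f x \<in> C"
proof -
  obtain q where q: "Poly_Mapping.keys q \<subseteq> C \<times> C" "tensor_eq sH sH (\<Delta> x) q"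
    using C x unfolding subcoalgebra_def tensor_sub_def by blast
  have sub: "subspace C" using C by (simp add: subcoalgebra_def)
  have "slice_left f x = bilift sH (\<lambda>a b. sH (f a) b) q"
    unfolding slice_left_def
    by (rule tensor_eq_bilift[OF vector_space_axioms _ _ q(2)])
       (simp_all add: slice_linear_simps functionalD[OF f])
  also have "\<dots> \<in> C"
    using q(1) by (intro bilift_in_subspace vector_space_axioms sub subspace_scale[OF sub]) auto
  finally show "slice_left f x \<in> C" .
  have "slice_right f x = bilift sH (\<lambda>a b. sH (f b) a) q"
    unfolding slice_right_def
    by (rule tensor_eq_bilift[OF vector_space_axioms _ _ q(2)])
       (simp_all add: slice_linear_simps functionalD[OF f])
  also have "\<dots> \<in> C"
    using q(1) by (intro bilift_in_subspace vector_space_axioms sub subspace_scale[OF sub]) auto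
  finally show "slice_right f x \<in> C" .
qed

text \<open>\<open>fin_dim\<close> asks for a spanning set inside \<open>E\<close>. A maximal
  independent subset of \<open>E\<close> is one, and it is finite because it is independent within
  the span of a finite set.\<close>

lemma fin_dim_subspaceI:
  assumes "finite K" "E \<subseteq> span K"
  shows "fin_dim sH E"
proof -
  obtain B where "B \<subseteq> E" "independent B" "E \<subseteq> span B"
    using maximal_independent_subset[of E] by metis
  with independent_span_bound[OF assms(1), of B] assms(2) show ?thesis
    unfolding fin_dim_def by blast
qed

text \<open>The fundamental theorem of coalgebras. \<open>E\<close> is spanned by all two-sided
  slices of \<open>x\<close>; the convolution identities make it stable under slicing, so
  \<open>tensor_sub_slicesI\<close> applies. Slicing by the counit on both sides recovers
  \<open>x\<close>, and slices of elements of \<open>C\<close> stay in \<open>C\<close>.\<close>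

lemma finite_dimensional_subcoalgebra:
  assumes C: "subcoalgebra sH \<Delta> C" and x: "x \<in> C"
  obtains E where "subcoalgebra sH \<Delta> E" "fin_dim sH E" "x \<in> E" "E \<subseteq> C"
proof -
  let ?G = "{slice_left f (slice_right g x) | f g. functional f \<and> functional g}"
  define E where "E = span ?G"
  have sub: "subspace E" by (simp add: E_def)
  have "slice_left f y \<in> E" if f: "functional f" and y: "y \<in> E" for f y
  proof -
    have "slice_left f z \<in> E" if zG: "z \<in> ?G" for z
    proof -
      obtain f' g where "functional f'" "functional g" and z: "z = slice_left f' (slice_right g x)"
        using zG by blast
      then show ?thesis
        unfolding E_def z slice_left_slice_left[OF f \<open>functional f'\<close>]
        using functional_convolution[OF \<open>functional f'\<close> f] by (intro span_base) blast
    qed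
    then have "?G \<subseteq> slice_left f -` E" by blast
    moreover have "subspace (slice_left f -` E)"
      using linear_subspace_vimage[OF linear_slice(1)[OF f] sub] .
    ultimately show ?thesis
      using y unfolding E_def by (blast dest: span_minimal)
  qed
  moreover have "slice_right f y \<in> E" if f: "functional f" and y: "y \<in> E" for f y
  proof -
    have "slice_right f z \<in> E" if zG: "z \<in> ?G" for z
    proof -
      obtain f' g where "functional f'" "functional g" and z: "z = slice_left f' (slice_right g x)"
        using zG by blast
      then show ?thesis
        unfolding E_def z slice_right_slice_left[OF f \<open>functional f'\<close>]
          slice_right_slice_right[OF f \<open>functional g\<close>]
        using functional_convolution[OF f \<open>functional g\<close>] by (intro span_base) blast
    qed
    then have "?G \<subseteq> slice_right f -` E" by blast
    moreover have "subspace (slice_right f -` E)"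
      using linear_subspace_vimage[OF linear_slice(2)[OF f] sub] .
    ultimately show ?thesis
      using y unfolding E_def by (blast dest: span_minimal)
  qed
  ultimately have "\<Delta> y \<in> tensor_sub sH sH E E" if "y \<in> E" for y
    using that unfolding slice_left_def slice_right_def
    by (intro tensor_sub_slicesI vector_space_axioms sub)
  then have "subcoalgebra sH \<Delta> E" unfolding subcoalgebra_def using sub by blast
  moreover have "fin_dim sH E"
  proof (rule fin_dim_subspaceI)
    \<comment> \<open>Right slices of \<open>x\<close> lie in the span of the first legs
      \<open>K\<close> of \<open>\<Delta> x\<close>, and left slices of those in the span of the
      second legs \<open>K'\<close> of the \<open>\<Delta> y\<close> with \<open>y \<in> K\<close>,
      whatever the functionals are.\<close>
    define K where "K = fst ` Poly_Mapping.keys (\<Delta> x)"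
    define K' where "K' = (\<Union>y\<in>K. snd ` Poly_Mapping.keys (\<Delta> y))"
    show "finite K'" by (simp add: K_def K'_def)
    have K: "slice_right g x \<in> span K" for g
      unfolding slice_right_def K_def
      by (intro bilift_in_subspace vector_space_axioms subspace_span span_scale span_base) force
    have "slice_left f y \<in> span K'" if f: "functional f" and y: "y \<in> span K" for f y
    proof -
      have "slice_left f z \<in> span K'" if "z \<in> K" for z
        unfolding slice_left_def K'_def using that
        by (intro bilift_in_subspace vector_space_axioms subspace_span span_scale span_base) force
      then have "K \<subseteq> slice_left f -` span K'" by blast
      moreover have "subspace (slice_left f -` span K')"
        using linear_subspace_vimage[OF linear_slice(1)[OF f] subspace_span] .
      ultimately show ?thesis
        using y by (blast dest: span_minimal)
    qed
    with K show "E \<subseteq> span K'"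
      unfolding E_def by (intro span_minimal) auto
  qed
  moreover have "x \<in> E"
    unfolding E_def by (rule span_base) (force intro: functional_counit)
  moreover have "E \<subseteq> C"
    unfolding E_def using slice_subcoalgebra[OF C] x C
    by (intro span_minimal) (auto simp: subcoalgebra_def)
  ultimately show ?thesis by (rule that)
qed

end


section \<open>Reductors\<close>

context hopf_galois_setting
begin

lemma vector_spaces [simp]: "vector_space sH" "vector_space sA" "vector_space sS"
  "vector_space (scale_fract sA)"
  using \<Lambda>.vector_space_axioms \<Lambda>.A.vector_space_axioms smash.vector_space_axioms
    A.vector_space_axioms .

text \<open>Condition (R2) is the vanishing of this expression on the subcoalgebra. It is kept as a
  function of both arguments, since products of formal sums become convolution products in
  \<open>x\<close>.\<close>

definition pairing :: "(('a \<times> 'a) \<Rightarrow>\<^sub>0 'k) \<Rightarrow> 'h \<Rightarrow> 'a"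
  where "pairing R x = bilift sA (\<lambda>r s. r * act x s) R"

lemma linear_pairing_left: "Vector_Spaces.linear fsmult sA (\<lambda>R. pairing R x)"
  unfolding pairing_def by (rule linear_bilift) simp

lemma linear_pairing_right: "Vector_Spaces.linear sH sA (pairing R)"
proof -
  have "Vector_Spaces.linear sH sA (\<lambda>x. r * act x s)" for r s
    using \<Lambda>.act_linear_left[of s]
    by (simp add: Vector_Spaces.linear_iff distrib_left \<Lambda>.A.scale_mult_right)
  then show ?thesis unfolding pairing_def[abs_def] by (intro linear_bilift_fun) auto
qed

lemma linear_times_left: "Vector_Spaces.linear t sA f \<Longrightarrow> Vector_Spaces.linear t sA (\<lambda>x. f x * a)"
  and linear_times_right: "Vector_Spaces.linear t sA f \<Longrightarrow> Vector_Spaces.linear t sA (\<lambda>x. a * f x)"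
  by (simp_all add: Vector_Spaces.linear_iff distrib_left distrib_right
      \<Lambda>.A.scale_mult_left \<Lambda>.A.scale_mult_right)

text \<open>On pure tensors this is the module algebra rule for products, with the outer factors
  collected by commutativity of \<open>\<Lambda>\<close>.\<close>

lemma pairing_tensor_mult:
  "pairing (tensor_mult R Q) x = bilift sA (\<lambda>y z. pairing R y * pairing Q z) (\<Delta> x)"
proof (rule linear_eqI_pure_tensor[of sA _ _ R])
  note lin = linear_compose_fun[OF linear_pairing_left linear_tensor_mult_left]
    linear_compose_fun[OF linear_pairing_left linear_tensor_mult_right]
  show "Vector_Spaces.linear fsmult sA (\<lambda>R. pairing (tensor_mult R Q) x)" by (rule lin)
  show "Vector_Spaces.linear fsmult sA (\<lambda>R. bilift sA (\<lambda>y z. pairing R y * pairing Q z) (\<Delta> x))"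
    by (intro linear_bilift_fun vector_space_fsmult linear_times_left linear_pairing_left) simp
  fix a b
  show "pairing (tensor_mult (pure_tensor a b) Q) x
      = bilift sA (\<lambda>y z. pairing (pure_tensor a b) y * pairing Q z) (\<Delta> x)"
  proof (rule linear_eqI_pure_tensor[of sA _ _ Q])
    show "Vector_Spaces.linear fsmult sA (\<lambda>Q. pairing (tensor_mult (pure_tensor a b) Q) x)" by (rule lin)
    show "Vector_Spaces.linear fsmult sA
        (\<lambda>Q. bilift sA (\<lambda>y z. pairing (pure_tensor a b) y * pairing Q z) (\<Delta> x))"
      by (intro linear_bilift_fun vector_space_fsmult linear_times_right linear_pairing_left) simp
    fix c d
    have "Vector_Spaces.linear sA sA ((*) (a * c))"
      by (simp add: Vector_Spaces.linear_iff distrib_left \<Lambda>.A.scale_mult_right)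
    note this[THEN linear_bilift_comp]
    then show "pairing (tensor_mult (pure_tensor a b) (pure_tensor c d)) x
        = bilift sA (\<lambda>y z. pairing (pure_tensor a b) y * pairing (pure_tensor c d) z) (\<Delta> x)"
      by (simp add: tensor_mult_pure pairing_def \<Lambda>.act_mult_right mult_ac)
  qed
qed

text \<open>Quantifying over all multiples of \<open>R\<close> makes this set grow when \<open>R\<close> is multiplied, so that
  reductors for several subcoalgebras can be combined into one.\<close>

definition annihilated :: "(('a \<times> 'a) \<Rightarrow>\<^sub>0 'k) \<Rightarrow> 'h set"
  where "annihilated R = {x. \<forall>Q. pairing (tensor_mult R Q) x = 0}"

lemma subspace_annihilated: "module.subspace sH (annihilated R)"
proof -
  have "annihilated R = (\<Inter>Q. pairing (tensor_mult R Q) -` {0})"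
    by (auto simp: annihilated_def)
  then show ?thesis
    using linear_subspace_vimage[OF linear_pairing_right \<Lambda>.A.subspace_single_0]
    by (auto intro: \<Lambda>.subspace_Inter)
qed

lemma annihilated_tensor_mult_left: "annihilated R \<subseteq> annihilated (tensor_mult R R')"
  by (auto simp: annihilated_def tensor_mult_assoc)

lemma annihilated_tensor_mult_right: "annihilated R' \<subseteq> annihilated (tensor_mult R R')"
  using annihilated_tensor_mult_left tensor_mult_commute by metis

lemma pairing_eq_0: "x \<in> annihilated R \<Longrightarrow> pairing (tensor_mult R Q) x = 0"
  by (simp add: annihilated_def)

text \<open>The first legs of \<open>\<Delta> x\<close> stay in \<open>C\<close>, so the factor
  \<open>pairing R y\<close> vanishes whatever \<open>Q\<close> contributes through the second
  legs.\<close>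

lemma reductor_annihilated:
  assumes C: "subcoalgebra sH \<Delta> C" and R: "reductor sA act m C R"
  shows "C \<subseteq> annihilated R"
proof
  fix x assume "x \<in> C"
  then obtain q where q: "Poly_Mapping.keys q \<subseteq> C \<times> C" "tensor_eq sH sH (\<Delta> x) q"
    using C unfolding subcoalgebra_def tensor_sub_def by blast
  have "pairing (tensor_mult R Q) x = 0" for Q
  proof -
    have "pairing (tensor_mult R Q) x = bilift sA (\<lambda>y z. pairing R y * pairing Q z) q"
      unfolding pairing_tensor_mult
      by (intro tensor_eq_bilift[OF _ _ _ q(2)] linear_times_left linear_times_right
          linear_pairing_right) simp
    also have "\<dots> = 0"
      using R q(1) by (intro bilift_zero_fun) (auto simp: reductor_def pairing_def)
    finally show ?thesis .
  qed
  then show "x \<in> annihilated R" by (simp add: annihilated_def)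
qed

lemma invertible_mod_one: "invertible_mod sA m (pure_tensor 1 1)"
proof (rule invertible_modI[of 0 m 0])
  show "tensor_eq sA sA (tensor_mult (pure_tensor 1 1) (pure_tensor 1 1)) (pure_tensor 1 1 + (0 + 0))"
    by (simp add: tensor_mult_one_left tensor_eq_refl)
qed auto

lemma superfluous_part_annihilated:
  assumes m: "maximal_ideal m" and Z: "finite Z" "Z \<subseteq> superfluous_part sH \<Delta> sA act m"
  obtains R where "invertible_mod sA m R" "Z \<subseteq> annihilated R"
proof -
  have mult: "invertible_mod sA m (tensor_mult R R')"
    if "invertible_mod sA m R" "invertible_mod sA m R'" for R R'
    using that maximal_ideal_mult[OF m]
    by (intro invertible_mod_mult \<Lambda>.A.k_algebra_axioms) (auto simp: mult.commute)
  have single: "\<exists>R. invertible_mod sA m R \<and> z \<in> annihilated R"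
    if "z \<in> superfluous_part sH \<Delta> sA act m" for z
    using that unfolding superfluous_part_def
  proof (induction rule: \<Lambda>.span_induct_alt)
    case base
    show ?case using invertible_mod_one \<Lambda>.subspace_0[OF subspace_annihilated] by blast
  next
    case (step c x y)
    from step(1) obtain C where C: "subcoalgebra sH \<Delta> C" "superfluous sH \<Delta> sA act m C" "x \<in> C"
      by blast
    obtain E where E: "subcoalgebra sH \<Delta> E" "fin_dim sH E" "x \<in> E" "E \<subseteq> C"
      using \<Lambda>.finite_dimensional_subcoalgebra[OF C(1,3)] .
    then obtain R where R: "reductor sA act m E R"
      using C(2) unfolding superfluous_def by blast
    with reductor_annihilated[OF E(1) R] E(3)
    have R: "invertible_mod sA m R" "x \<in> annihilated R" by (auto simp: reductor_def)
    from step(2) obtain R' where R': "invertible_mod sA m R'" "y \<in> annihilated R'" by blast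
    have "sH c x + y \<in> annihilated (tensor_mult R R')"
      using subsetD[OF annihilated_tensor_mult_left R(2)] subsetD[OF annihilated_tensor_mult_right R'(2)]
      by (intro \<Lambda>.subspace_add[OF subspace_annihilated] \<Lambda>.subspace_scale[OF subspace_annihilated])
    with mult[OF R(1) R'(1)] show ?case by blast
  qed
  from Z have "\<exists>R. invertible_mod sA m R \<and> Z \<subseteq> annihilated R"
  proof (induction Z rule: finite_induct)
    case empty
    then show ?case using invertible_mod_one by blast
  next
    case (insert z Z)
    then obtain R R' where "invertible_mod sA m R" "Z \<subseteq> annihilated R"
      "invertible_mod sA m R'" "z \<in> annihilated R'"
      using single[of z] by auto
    then show ?case
      using mult annihilated_tensor_mult_left[of R R'] annihilated_tensor_mult_right[of R' R]
      by (intro exI[of _ "tensor_mult R R'"]) auto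
  qed
  then show ?thesis using that by blast
qed

section \<open>The action of \<open>\<Lambda> \<otimes> \<Lambda>\<close> on the smash
  product\<close>

definition \<iota> :: "'a \<Rightarrow> 's"
  where "\<iota> a = \<iota>L (to_fract a)"

lemma \<iota>L_simps: "\<iota>L (f + g) = \<iota>L f + \<iota>L g" "\<iota>L (f * g) = \<iota>L f * \<iota>L g" "\<iota>L 1 = 1"
  "\<iota>L (scale_fract sA c f) = sS c (\<iota>L f)" "\<iota>L 0 = 0"
proof -
  interpret Vector_Spaces.linear "scale_fract sA" sS \<iota>L
    using hom_A by (simp add: algebra_hom_def)
  show "\<iota>L 0 = 0" by simp
qed (use hom_A in \<open>auto simp: algebra_hom_def Vector_Spaces.linear_iff\<close>)

lemma \<iota>H_simps: "\<iota>H (x + y) = \<iota>H x + \<iota>H y" "\<iota>H (x * y) = \<iota>H x * \<iota>H y" "\<iota>H 1 = 1"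
  "\<iota>H (sH c x) = sS c (\<iota>H x)"
  using hom_H by (auto simp: algebra_hom_def Vector_Spaces.linear_iff)

lemma to_fract_scale: "to_fract (sA c a) = scale_fract sA c (to_fract a)"
  using \<Lambda>.A.scale_mult_left[of c 1 a] by (simp add: scale_fract_def flip: to_fract_mult)

lemma \<iota>_simps: "\<iota> (a + b) = \<iota> a + \<iota> b" "\<iota> (a * b) = \<iota> a * \<iota> b" "\<iota> 1 = 1" "\<iota> 0 = 0"
  "\<iota> (sA c a) = sS c (\<iota> a)"
  by (simp_all add: \<iota>_def \<iota>L_simps to_fract_scale)

definition biact :: "(('a \<times> 'a) \<Rightarrow>\<^sub>0 'k) \<Rightarrow> 's \<Rightarrow> 's"
  where "biact R X = bilift sS (\<lambda>r s. \<iota> r * X * \<iota> s) R"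

lemma linear_biact_left: "Vector_Spaces.linear fsmult sS (\<lambda>R. biact R X)"
  unfolding biact_def by (rule linear_bilift) simp

lemmas smash_linear_simps = Vector_Spaces.linear_iff distrib_left distrib_right
  smash.scale_mult_left smash.scale_mult_right

lemma linear_biact_right: "Vector_Spaces.linear sS sS (biact R)"
  unfolding biact_def[abs_def]
  by (intro linear_bilift_fun) (simp_all add: smash_linear_simps)

lemma biact_pure: "biact (pure_tensor a b) X = \<iota> a * X * \<iota> b"
  by (simp add: biact_def)

text \<open>The right multipliers come out in reverse order, which commutativity of
  \<open>\<Lambda>\<close> repairs.\<close>

lemma biact_tensor_mult: "biact (tensor_mult R Q) X = biact R (biact Q X)"
proof (rule linear_eqI_pure_tensor[of sS _ _ R])
  show "Vector_Spaces.linear fsmult sS (\<lambda>R. biact (tensor_mult R Q) X)"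
    by (rule linear_compose_fun[OF linear_biact_left linear_tensor_mult_left])
  show "Vector_Spaces.linear fsmult sS (\<lambda>R. biact R (biact Q X))"
    by (rule linear_biact_left)
  fix a b
  show "biact (tensor_mult (pure_tensor a b) Q) X = biact (pure_tensor a b) (biact Q X)"
  proof (rule linear_eqI_pure_tensor[of sS _ _ Q])
    show "Vector_Spaces.linear fsmult sS (\<lambda>Q. biact (tensor_mult (pure_tensor a b) Q) X)"
      by (rule linear_compose_fun[OF linear_biact_left linear_tensor_mult_right])
    show "Vector_Spaces.linear fsmult sS (\<lambda>Q. biact (pure_tensor a b) (biact Q X))"
      by (rule linear_compose_fun[OF linear_biact_right linear_biact_left])
    fix c d
    have "\<iota> b * \<iota> d = \<iota> d * \<iota> b" using \<iota>_simps(2) by (metis mult.commute)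
    then show "biact (tensor_mult (pure_tensor a b) (pure_tensor c d)) X
        = biact (pure_tensor a b) (biact (pure_tensor c d) X)"
      by (simp add: tensor_mult_pure biact_pure \<iota>_simps mult.assoc)
  qed
qed

lemma biact_tensor_eq:
  assumes "tensor_eq sA sA R Q"
  shows "biact R X = biact Q X"
  unfolding biact_def
  by (rule tensor_eq_bilift[OF _ _ _ assms]) (simp_all add: smash_linear_simps \<iota>_simps)

lemma \<iota>L_commute: "\<iota>L f * \<iota>L g = \<iota>L g * \<iota>L f"
  using \<iota>L_simps(2) by (metis mult.commute)

text \<open>\<open>f\<close> passes to the left because \<open>L\<close> is commutative, and the
  smash relation moves \<open>s\<close> past \<open>x\<close>, turning the first leg of
  \<open>\<Delta> x\<close> into the coefficient \<open>pairing R y\<close>. Terms whose first leg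
  pairs to zero with \<open>R\<close> thus disappear.\<close>

lemma biact_smash:
  "biact R (\<iota>L f * \<iota>H x) = \<iota>L f * bilift sS (\<lambda>y z. \<iota> (pairing R y) * \<iota>H z) (\<Delta> x)"
proof (rule linear_eqI_pure_tensor[of sS _ _ R])
  show "Vector_Spaces.linear fsmult sS (\<lambda>R. biact R (\<iota>L f * \<iota>H x))"
    by (rule linear_biact_left)
  have "Vector_Spaces.linear fsmult sS (\<lambda>R. \<iota> (pairing R y) * \<iota>H z)" for y z
    using linear_pairing_left[of y] by (simp add: smash_linear_simps \<iota>_simps)
  then have "Vector_Spaces.linear fsmult sS (\<lambda>R. bilift sS (\<lambda>y z. \<iota> (pairing R y) * \<iota>H z) (\<Delta> x))"
    by (intro linear_bilift_fun vector_space_fsmult) simp_all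
  then show "Vector_Spaces.linear fsmult sS
      (\<lambda>R. \<iota>L f * bilift sS (\<lambda>y z. \<iota> (pairing R y) * \<iota>H z) (\<Delta> x))"
    by (simp add: smash_linear_simps)
  fix r s
  have lin: "Vector_Spaces.linear sS sS ((*) (\<iota> r))"
    by (simp add: smash_linear_simps)
  have "biact (pure_tensor r s) (\<iota>L f * \<iota>H x) = \<iota>L f * (\<iota> r * (\<iota>H x * \<iota> s))"
    by (simp add: biact_pure \<iota>_def \<iota>L_commute flip: mult.assoc)
  also have "\<iota>H x * \<iota> s = bilift sS (\<lambda>y z. \<iota> (act y s) * \<iota>H z) (\<Delta> x)"
    by (simp add: \<iota>_def smash_relation act_extends)
  also have "\<iota> r * \<dots> = bilift sS (\<lambda>y z. \<iota> r * (\<iota> (act y s) * \<iota>H z)) (\<Delta> x)"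
    by (rule linear_bilift_comp[OF lin])
  also have "\<dots> = bilift sS (\<lambda>y z. \<iota> (pairing (pure_tensor r s) y) * \<iota>H z) (\<Delta> x)"
    by (simp add: pairing_def \<iota>_simps mult.assoc)
  finally show "biact (pure_tensor r s) (\<iota>L f * \<iota>H x) =
    \<iota>L f * bilift sS (\<lambda>y z. \<iota> (pairing (pure_tensor r s) y) * \<iota>H z) (\<Delta> x)" .
qed

end


section \<open>Finiteness over noetherian rings\<close>

lemma module_mult: "module ((*) :: 'a::comm_ring_1 \<Rightarrow> 'a \<Rightarrow> 'a)"
  by unfold_locales (auto simp: algebra_simps)

text \<open>The maps \<open>e i\<close> with \<open>i \<in> A\<close> embed \<open>N\<close> into a
  finite power of the noetherian ring. In the induction on \<open>A\<close>, the values of one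
  \<open>e i\<close> on \<open>N\<close> form an ideal, whose finitely many generators are lifted to
  \<open>N\<close> by \<open>h\<close>; the kernel of \<open>e i\<close> in \<open>N\<close> is
  covered by the induction hypothesis.\<close>

lemma noetherian_finitely_generated:
  fixes s :: "'a::idom \<Rightarrow> 'm::ab_group_add \<Rightarrow> 'm" and e :: "'i \<Rightarrow> 'm \<Rightarrow> 'a fract"
  assumes "module s" "noetherian TYPE('a)" "finite A"
    and N: "module.subspace s N"
    and add: "\<And>i x y. e i (x + y) = e i x + e i y"
    and scale: "\<And>i a x. e i (s a x) = to_fract a * e i x"
    and "\<And>i x. i \<in> A \<Longrightarrow> x \<in> N \<Longrightarrow> e i x \<in> range to_fract"
    and "\<And>x. x \<in> N \<Longrightarrow> (\<And>i. i \<in> A \<Longrightarrow> e i x = 0) \<Longrightarrow> x = 0"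
  shows "\<exists>G. finite G \<and> G \<subseteq> N \<and> N \<subseteq> module.span s G"
  using assms(3) N assms(7,8)
proof (induction A arbitrary: N rule: finite_induct)
  case empty
  then have "N \<subseteq> {0}" by blast
  then show ?case by (intro exI[of _ "{}"]) (simp add: module.span_empty[OF assms(1)])
next
  case (insert i A)
  interpret module s by fact
  interpret R: module "(*) :: 'a \<Rightarrow> 'a \<Rightarrow> 'a" by (rule module_mult)
  have e0: "e i 0 = 0" for i using add[of i 0 0] by (metis add.right_neutral add_left_cancel)
  let ?N = "N \<inter> {x. e i x = 0}"
  have "subspace ?N"
    using insert.prems(1) by (auto simp: subspace_def add scale e0)
  moreover have "x = 0" if "x \<in> ?N" "\<And>j. j \<in> A \<Longrightarrow> e j x = 0" for x
    using that insert.prems(3)[of x] by auto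
  ultimately obtain G where G: "finite G" "G \<subseteq> ?N" "?N \<subseteq> span G"
    using insert.IH[of ?N] insert.prems(2) by auto
  define I where "I = {a. \<exists>x\<in>N. e i x = to_fract a}"
  have "R.subspace I"
    unfolding R.subspace_def I_def
  proof (intro conjI ballI allI; clarsimp?)
    show "\<exists>x\<in>N. e i x = 0" using subspace_0[OF insert.prems(1)] e0 by blast
    show "\<exists>z\<in>N. e i z = to_fract a + to_fract b"
      if "x \<in> N" "e i x = to_fract a" "y \<in> N" "e i y = to_fract b" for a b x y
      using that subspace_add[OF insert.prems(1), of x y] add by metis
    show "\<exists>z\<in>N. e i z = to_fract c * to_fract a" if "x \<in> N" "e i x = to_fract a" for a c x
      using that subspace_scale[OF insert.prems(1), of x c] scale by metis
  qed
  then obtain B where B: "finite B" "I = R.span B"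
    using assms(2) unfolding noetherian_def ideal_def by blast
  then have "\<forall>b\<in>B. \<exists>x\<in>N. e i x = to_fract b"
    using R.span_base unfolding I_def by blast
  then obtain h where h: "\<And>b. b \<in> B \<Longrightarrow> h b \<in> N" "\<And>b. b \<in> B \<Longrightarrow> e i (h b) = to_fract b"
    by metis
  have lift: "\<exists>y\<in>span (h ` B). e i y = to_fract a" if "a \<in> R.span B" for a
    using that
  proof (induction rule: R.span_induct_alt)
    case base
    show ?case using e0 by (intro bexI[of _ 0]) (auto intro: span_zero)
  next
    case (step c b a)
    then obtain y where "y \<in> span (h ` B)" "e i y = to_fract a" by blast
    moreover from step(1) this have "s c (h b) + y \<in> span (h ` B)"
      by (intro span_add span_scale) (auto intro: span_base)
    ultimately show ?case
      using h(2)[OF step(1)] by (intro bexI[of _ "s c (h b) + y"]) (auto simp: add scale)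
  qed
  have hN: "span (h ` B) \<subseteq> N"
    using h(1) insert.prems(1) by (intro span_minimal) auto
  have "N \<subseteq> span (G \<union> h ` B)"
  proof
    fix x assume x: "x \<in> N"
    then obtain a where a: "e i x = to_fract a" using insert.prems(2)[of i x] by auto
    with x have "a \<in> R.span B" using B(2) unfolding I_def by blast
    from lift[OF this] obtain y where y: "y \<in> span (h ` B)" "e i y = to_fract a" by blast
    have "e i (x - y) = 0" using add[of i "x - y" y] a y(2) by simp
    moreover have "x - y \<in> N" using x y hN by (intro subspace_diff[OF insert.prems(1)]) auto
    ultimately have "x - y \<in> span (G \<union> h ` B)"
      using G(3) span_mono[of G "G \<union> h ` B"] by blast
    moreover have "y \<in> span (G \<union> h ` B)"
      using y(1) span_mono[of "h ` B" "G \<union> h ` B"] by blast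
    ultimately show "x \<in> span (G \<union> h ` B)" using span_add by fastforce
  qed
  then show ?case
    using G B(1) h(1) by (intro exI[of _ "G \<union> h ` B"]) auto
qed

text \<open>If \<open>A\<close> separates the span of \<open>D\<close>, its common kernel in the
  span of \<open>insert d D\<close> is at most one-dimensional, so one further index
  \<open>j\<close> that is nonzero on a kernel vector \<open>z\<close> suffices.\<close>

lemma finite_separating_functionals:
  fixes s :: "'l::field \<Rightarrow> 'm::ab_group_add \<Rightarrow> 'm" and e :: "'i \<Rightarrow> 'm \<Rightarrow> 'l"
  assumes "vector_space s" "finite D"
    and add: "\<And>i x y. e i (x + y) = e i x + e i y"
    and scale: "\<And>i a x. e i (s a x) = a * e i x"
    and "\<And>x. x \<in> module.span s D \<Longrightarrow> (\<And>i. e i x = 0) \<Longrightarrow> x = 0"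
  shows "\<exists>A. finite A \<and> (\<forall>x \<in> module.span s D. (\<forall>i\<in>A. e i x = 0) \<longrightarrow> x = 0)"
  using assms(2,5)
proof (induction D rule: finite_induct)
  case empty
  interpret vector_space s by fact
  show ?case by auto
next
  case (insert d D)
  interpret vector_space s by fact
  have diff: "e i (x - y) = e i x - e i y" for i x y
    using add[of i "x - y" y] by simp
  obtain A where A: "finite A" "\<And>x. x \<in> span D \<Longrightarrow> \<forall>i\<in>A. e i x = 0 \<Longrightarrow> x = 0"
    using insert.IH insert.prems span_mono[of D "insert d D"] by blast
  let ?K = "{x \<in> span (insert d D). \<forall>i\<in>A. e i x = 0}"
  show ?case
  proof (cases "?K \<subseteq> {0}")
    case True
    with A(1) show ?thesis by blast
  next
    case False
    then obtain z where z: "z \<in> span (insert d D)" "\<forall>i\<in>A. e i z = 0" "z \<noteq> 0" by blast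
    from insert.prems[OF z(1)] z(3) obtain j where j: "e j z \<noteq> 0" by blast
    from z(1) obtain c where c: "z - s c d \<in> span D" unfolding span_insert by blast
    \<comment> \<open>Otherwise \<open>z\<close> would lie in the span of \<open>D\<close>, where
      \<open>A\<close> already separates.\<close>
    have "c \<noteq> 0" using A(2)[of z] c z by auto
    have "x = 0" if x: "x \<in> span (insert d D)" "\<forall>i\<in>insert j A. e i x = 0" for x
    proof -
      from x(1) obtain b where b: "x - s b d \<in> span D" unfolding span_insert by blast
      \<comment> \<open>The multiple of \<open>z\<close> cancels the \<open>d\<close>-component of
        \<open>x\<close>, while the indices in \<open>A\<close> still vanish on
        \<open>y\<close>.\<close>
      define y where "y = x - s (b / c) z"
      have "y = (x - s b d) - s (b / c) (z - s c d)"
        using \<open>c \<noteq> 0\<close> by (simp add: y_def scale_right_diff_distrib)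
      then have "y \<in> span D" using b c by (simp only: span_diff span_scale)
      moreover have "\<forall>i\<in>A. e i y = 0" using x(2) z(2) by (simp add: y_def diff scale)
      ultimately have "y = 0" using A(2) by blast
      then have "x = s (b / c) z" by (simp add: y_def)
      moreover from this have "b / c = 0" using x(2) j by (simp add: scale)
      ultimately show "x = 0" by (simp only: scale_zero_left)
    qed
    with A(1) show ?thesis by (intro exI[of _ "insert j A"]) auto
  qed
qed

lemma ideal_ideal_power: "ideal (ideal_power I n)"
proof -
  interpret R: module "(*) :: 'a::comm_ring_1 \<Rightarrow> 'a \<Rightarrow> 'a" by (rule module_mult)
  show "ideal (ideal_power I n)" for I :: "'a set"
    by (cases n) (auto simp: ideal_def)
qed

lemma ideal_power_mult:
  assumes "a \<in> ideal_power I n"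
  shows "b * a \<in> ideal_power I n"
  using ideal_ideal_power[of I n] assms module.subspace_scale[OF module_mult]
  unfolding ideal_def by blast

lemma mult_in_ideal_power_Suc:
  "a \<in> I \<Longrightarrow> b \<in> ideal_power I n \<Longrightarrow> a * b \<in> ideal_power I (Suc n)"
  by (auto intro!: module.span_base[OF module_mult])

lemma ideal_power_antimono:
  assumes "n \<le> n'"
  shows "ideal_power I n' \<subseteq> ideal_power I n"
  using assms
proof (induction n' rule: dec_induct)
  case (step n')
  have "ideal_power I (Suc n') \<subseteq> ideal_power I n'"
    using ideal_ideal_power[of I n'] ideal_power_mult unfolding ideal_def ideal_power.simps
    by (intro module.span_minimal[OF module_mult]) auto
  with step show ?case by blast
qed simp

text \<open>Modulo \<open>I\<close> finitely many elements suffice. The remainder is a combination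
  of the ideal generators \<open>B\<close>, whose coefficients matter only modulo the
  \<open>n\<close>-th power, since an error there times an element of \<open>I\<close> falls into
  the next power. Products of elements of \<open>G\<close> and \<open>B\<close> therefore complete
  the spanning set.\<close>

lemma fin_dim_quotient_ideal_power:
  fixes sA :: "'k::field \<Rightarrow> 'a::idom \<Rightarrow> 'a"
  assumes A: "k_algebra sA" and "noetherian TYPE('a)" and I: "ideal I" "fin_dim_quotient sA UNIV I"
  shows "\<exists>G. finite G \<and> (\<forall>a. \<exists>g\<in>module.span sA G. a - g \<in> ideal_power I n)"
proof (induction n)
  case 0
  interpret k_algebra sA by fact
  show ?case by (intro exI[of _ "{}"]) auto
next
  case (Suc n)
  interpret k_algebra sA by fact
  interpret R: module "(*) :: 'a \<Rightarrow> 'a \<Rightarrow> 'a" by (rule module_mult)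
  have In: "R.subspace (ideal_power I (Suc n))"
    using ideal_ideal_power[of I "Suc n"] by (simp add: ideal_def)
  obtain G where G: "finite G" "\<And>a. \<exists>g\<in>span G. a - g \<in> ideal_power I n"
    using Suc by blast
  obtain B where B: "finite B" "I = R.span B"
    using assms(2) I(1) unfolding noetherian_def by blast
  obtain G1 where G1: "finite G1" "\<And>a. \<exists>g\<in>span G1. a - g \<in> I"
    using I(2) unfolding fin_dim_quotient_def by blast
  define G' where "G' = (\<lambda>(g, b). g * b) ` (G \<times> B)"
  have in_G': "g * b \<in> span G'" if "g \<in> span G" "b \<in> B" for g b
    using that(1)
  proof (induction rule: span_induct_alt)
    case (step c x y)
    with that(2) have "x * b \<in> span G'" by (intro span_base) (auto simp: G'_def)
    with step(2) show ?case by (auto simp: distrib_right scale_mult_left intro: span_add span_scale)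
  qed (simp add: span_zero)
  have lift: "\<exists>g\<in>span G'. x - g \<in> ideal_power I (Suc n)" if "x \<in> R.span B" for x
    using that
  proof (induction rule: R.span_induct_alt)
    case base
    show ?case using R.subspace_0[OF In] span_zero by (intro bexI[of _ 0]) auto
  next
    case (step c b y)
    then obtain h where h: "h \<in> span G'" "y - h \<in> ideal_power I (Suc n)" by blast
    obtain g where g: "g \<in> span G" "c - g \<in> ideal_power I n" using G(2) by blast
    have "b \<in> I" using step(1) B(2) R.span_base by blast
    then have "b * (c - g) \<in> ideal_power I (Suc n)" by (rule mult_in_ideal_power_Suc[OF _ g(2)])
    from R.subspace_add[OF In this h(2)]
    have "c * b + y - (g * b + h) \<in> ideal_power I (Suc n)" by (simp add: algebra_simps)
    with in_G'[OF g(1) step(1)] h(1) show ?case by (blast intro: span_add)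
  qed
  show ?case
  proof (intro exI conjI allI)
    show "finite (G1 \<union> G')" using G1(1) G(1) B(1) by (simp add: G'_def)
    fix a
    obtain g where g: "g \<in> span G1" "a - g \<in> I" using G1(2) by blast
    with lift B(2) obtain h where h: "h \<in> span G'" "a - g - h \<in> ideal_power I (Suc n)" by blast
    have "g + h \<in> span (G1 \<union> G')"
      using g(1) h(1) span_mono[of G1 "G1 \<union> G'"] span_mono[of G' "G1 \<union> G'"] by (intro span_add) auto
    with h(2) show "\<exists>g\<in>span (G1 \<union> G'). a - g \<in> ideal_power I (Suc n)"
      by (intro bexI[of _ "g + h"]) (simp_all add: algebra_simps)
  qed
qed

section \<open>Separating evaluations and finite generation of \<open>F \<inter> L D\<close>\<close>

context hopf_galois_setting
begin

lemma vector_space_\<iota>L: "vector_space (\<lambda>f X. \<iota>L f * X)"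
  by unfold_locales (simp_all add: \<iota>L_simps algebra_simps)

lemma module_\<iota>: "module (\<lambda>a X. \<iota> a * X)"
  by unfold_locales (simp_all add: \<iota>_simps algebra_simps)

abbreviation "L_span D \<equiv> module.span (\<lambda>f X. \<iota>L f * X) (\<iota>H ` D)"

abbreviation "hat \<equiv> smash_hat (scale_fract sA) actL sS \<iota>L \<iota>H"

lemma sS_eq: "sS c X = \<iota>L (scale_fract sA c 1) * X"
  by (simp add: \<iota>L_simps smash.scale_mult_left)

lemma hat_add: "hat (X + Y) g = hat X g + hat Y g"
proof -
  obtain p q where X: "X = smash_mult sS \<iota>L \<iota>H p" and Y: "Y = smash_mult sS \<iota>L \<iota>H q"
    using smash_mult_surj by metis
  have "X + Y = smash_mult sS \<iota>L \<iota>H (p + q)"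
    by (simp add: X Y smash_mult_def bilift_add)
  then show ?thesis by (simp add: X Y smash_hat_eq bilift_add)
qed

text \<open>Together with \<open>hat_add\<close> this makes evaluation at \<open>g\<close> an
  \<open>L\<close>-linear functional; \<open>q\<close> is obtained by multiplying the first entries
  of a representing sum by \<open>f\<close>.\<close>

lemma hat_\<iota>L: "hat (\<iota>L f * X) g = f * hat X g"
proof -
  obtain p where X: "X = smash_mult sS \<iota>L \<iota>H p"
    using smash_mult_surj by metis
  define q where "q = bilift fsmult (\<lambda>a x. pure_tensor (f * a) x) p"
  have "\<iota>L f * X = smash_mult sS \<iota>L \<iota>H q"
  proof -
    have "Vector_Spaces.linear sS sS ((*) (\<iota>L f))" by (simp add: smash_linear_simps)
    then show ?thesis
      by (simp add: X q_def smash_mult_def \<iota>L_simps mult.assoc linear_bilift_comp[where T = "(*) (\<iota>L f)"]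
          linear_bilift_comp[OF linear_bilift[OF vector_spaces(3)]])
  qed
  moreover have "f * hat X g = bilift (scale_fract sA) (\<lambda>f x. f * actL x g) q"
  proof -
    have "Vector_Spaces.linear (scale_fract sA) (scale_fract sA) ((*) f)"
      by (simp add: Vector_Spaces.linear_iff distrib_left A.scale_mult_right)
    then show ?thesis
      by (simp add: X q_def smash_hat_eq mult.assoc linear_bilift_comp[where T = "(*) f"]
          linear_bilift_comp[OF linear_bilift[OF vector_spaces(4)]])
  qed
  ultimately show ?thesis by (simp add: smash_hat_eq)
qed

lemma smash_sub_\<iota>:
  assumes "X \<in> smash_sub sS \<iota>L \<iota>H (range to_fract) C"
  shows "\<iota> a * X \<in> smash_sub sS \<iota>L \<iota>H (range to_fract) C"
  using assms unfolding smash_sub_def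
proof (induction rule: smash.span_induct_alt)
  case (step c x y)
  then obtain b z where x: "x = \<iota>L (to_fract b) * \<iota>H z" "z \<in> C" by blast
  then have "\<iota> a * x = \<iota>L (to_fract (a * b)) * \<iota>H z"
    by (simp add: \<iota>_def \<iota>L_simps mult.assoc)
  then have "\<iota> a * x \<in> smash.span {\<iota>L b * \<iota>H x |b x. b \<in> range to_fract \<and> x \<in> C}"
    using x(2) by (intro smash.span_base) blast
  with step(2) show ?case
    by (simp only: distrib_left smash.scale_mult_right smash.span_add smash.span_scale)
qed (simp add: smash.span_zero)

text \<open>Finitely many coefficients in \<open>L\<close> have a common denominator. Faithfulness,
  stated for \<open>\<Lambda> # H\<close>, is carried over to \<open>L # H\<close> in this
  way.\<close>

lemma L_span_denominator:
  assumes "X \<in> L_span C"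
  shows "\<exists>a. a \<noteq> 0 \<and> \<iota> a * X \<in> smash_sub sS \<iota>L \<iota>H (range to_fract) C"
proof -
  interpret L: vector_space "\<lambda>f X. \<iota>L f * X" by (rule vector_space_\<iota>L)
  show ?thesis using assms
  proof (induction rule: L.span_induct_alt)
    case base
    show ?case by (intro exI[of _ 1]) (simp add: smash_sub_def smash.span_zero)
  next
    case (step f x Y)
    then obtain c where c: "c \<noteq> 0" "\<iota> c * Y \<in> smash_sub sS \<iota>L \<iota>H (range to_fract) C" by blast
    from step(1) obtain z where z: "x = \<iota>H z" "z \<in> C" by blast
    obtain a b where ab: "f = Fract a b" "b \<noteq> 0" by (cases f)
    then have f: "to_fract b * f = to_fract a" by (simp add: Fract_conv_to_fract)
    have "\<iota> (b * c) * (\<iota>L f * x + Y) = \<iota>L (to_fract c * (to_fract b * f)) * x + \<iota> b * (\<iota> c * Y)"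
      by (simp add: \<iota>_def \<iota>L_simps distrib_left mult.assoc \<iota>L_commute[of "to_fract c" "to_fract b * f"]
          flip: \<iota>L_simps(2))
    also have "\<dots> = \<iota>L (to_fract (c * a)) * \<iota>H z + \<iota> b * (\<iota> c * Y)"
      by (simp add: f z)
    also have "\<dots> \<in> smash_sub sS \<iota>L \<iota>H (range to_fract) C"
    proof -
      have "\<iota>L (to_fract (c * a)) * \<iota>H z \<in> smash_sub sS \<iota>L \<iota>H (range to_fract) C"
        using z(2) unfolding smash_sub_def by (intro smash.span_base) blast
      then show ?thesis
        using smash_sub_\<iota>[OF c(2)] unfolding smash_sub_def by (rule smash.span_add)
    qed
    finally show ?case using c(1) ab(2) by (intro exI[of _ "b * c"]) auto
  qed
qed

text \<open>Faithfulness kills \<open>\<iota> c * X\<close> once denominators are cleared, and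
  \<open>\<iota> c\<close> cancels because \<open>to_fract c\<close> is invertible in
  \<open>L\<close>.\<close>

lemma hat_separates:
  assumes "X \<in> L_span H" "\<And>a. hat X (to_fract a) = 0"
  shows "X = 0"
proof -
  obtain c where c: "c \<noteq> 0" "\<iota> c * X \<in> smash_sub sS \<iota>L \<iota>H (range to_fract) H"
    using L_span_denominator[OF assms(1)] by blast
  have "\<iota> c * X = 0"
    using assms(2) by (intro faithful[OF c(2)]) (simp add: \<iota>_def hat_\<iota>L)
  then have "\<iota>L (inverse (to_fract c) * to_fract c) * X = 0"
    by (simp add: \<iota>L_simps mult.assoc \<iota>_def)
  then show ?thesis using c(1) by (simp add: \<iota>L_simps)
qed

lemma galois_order_finitely_generated:
  assumes F: "galois_order sA actL sS \<iota>L \<iota>H H F" and D: "finite D" "D \<subseteq> H"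
  shows "\<exists>G. finite G \<and> G \<subseteq> F \<inter> L_span D \<and> F \<inter> L_span D \<subseteq> module.span (\<lambda>a X. \<iota> a * X) G"
proof -
  interpret L: vector_space "\<lambda>f X. \<iota>L f * X" by (rule vector_space_\<iota>L)
  interpret M: module "\<lambda>a X. \<iota> a * X" by (rule module_\<iota>)
  have "L_span D \<subseteq> L_span H" using D(2) by (intro L.span_mono) auto
  \<comment> \<open>\<open>L_span D\<close> is finite-dimensional over \<open>L\<close>, so finitely
    many evaluations already separate its points.\<close>
  then have "\<exists>A. finite A \<and> (\<forall>X\<in>L_span D. (\<forall>a\<in>A. hat X (to_fract a) = 0) \<longrightarrow> X = 0)"
    using D(1) hat_separates
    by (intro finite_separating_functionals[OF L.vector_space_axioms, where e = "\<lambda>a X. hat X (to_fract a)"])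
       (auto simp: hat_add hat_\<iota>L)
  then obtain A where A: "finite A" "\<And>X. X \<in> L_span D \<Longrightarrow> \<forall>a\<in>A. hat X (to_fract a) = 0 \<Longrightarrow> X = 0"
    by blast
  have sub: "subalgebra sS F" and \<iota>F: "\<And>a. \<iota> a \<in> F"
    using F by (auto simp: galois_order_def \<iota>_def)
  show ?thesis
  proof (rule noetherian_finitely_generated[OF module_\<iota> noetherian A(1), where e = "\<lambda>a X. hat X (to_fract a)"])
    show "M.subspace (F \<inter> L_span D)"
      using sub \<iota>F unfolding M.subspace_def subalgebra_def smash.subspace_def
      by (auto intro: L.span_add L.span_zero L.span_scale simp: \<iota>_def)
  qed (use A(2) F in \<open>auto simp: hat_add hat_\<iota>L \<iota>_def galois_order_def\<close>)
qed

section \<open>Moving the filtered piece into finitely many second legs\<close>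

lemma coideal_filtration_subset: "coideal_filtration sH \<Delta> H r \<subseteq> H"
  by (auto simp: coideal_filtration_def)

lemma linear_smash_comult:
  "Vector_Spaces.linear sH sS (\<lambda>x. bilift sS (\<lambda>y z. \<iota> (pairing R y) * \<iota>H z) (\<Delta> x))"
  using linear_pairing_right[of R]
  by (intro \<Lambda>.bilift_comult_linear) (simp_all add: smash_linear_simps \<iota>_simps \<iota>H_simps)

lemma bilift_smash_tensor_eq:
  assumes "tensor_eq sH sH p q"
  shows "bilift sS (\<lambda>y z. \<iota> (pairing R y) * \<iota>H z) p = bilift sS (\<lambda>y z. \<iota> (pairing R y) * \<iota>H z) q"
  using linear_pairing_right[of R]
  by (intro tensor_eq_bilift[OF _ _ _ assms]) (simp_all add: smash_linear_simps \<iota>_simps \<iota>H_simps)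

lemma reduction_to_finite:
  assumes m: "maximal_ideal m"
    and stab: "fin_dim_Stab sH \<Delta> sA act (coideal_filtration sH \<Delta> H r) m"
  shows "\<exists>D. finite D \<and> D \<subseteq> H \<and>
    (\<forall>X\<in>smash_sub sS \<iota>L \<iota>H UNIV (coideal_filtration sH \<Delta> H r).
      \<exists>R. invertible_mod sA m R \<and> (\<forall>Q. biact (tensor_mult R Q) X \<in> L_span D))"
proof -
  interpret L: vector_space "\<lambda>f X. \<iota>L f * X" by (rule vector_space_\<iota>L)
  let ?C = "coideal_filtration sH \<Delta> H r"
  obtain B where B: "finite B" "B \<subseteq> ?C"
    "\<And>x. x \<in> ?C \<Longrightarrow> \<exists>y\<in>\<Lambda>.span B. x - y \<in> superfluous_coideal sH \<Delta> sA act ?C m"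
    using stab unfolding fin_dim_Stab_def fin_dim_quotient_def by blast
  \<comment> \<open>The left coideal property yields representatives with second legs in
    \<open>H\<close>; those legs for the finitely many \<open>b \<in> B\<close> will form
    \<open>D\<close>.\<close>
  have "\<exists>q. Poly_Mapping.keys q \<subseteq> UNIV \<times> H \<and> tensor_eq sH sH (\<Delta> b) q" if "b \<in> B" for b
    using that B(2) coideal_filtration_subset[of r] coideal
    unfolding left_coideal_subalgebra_def tensor_sub_def by blast
  then obtain q where q: "\<And>b. b \<in> B \<Longrightarrow> Poly_Mapping.keys (q b) \<subseteq> UNIV \<times> H"
    "\<And>b. b \<in> B \<Longrightarrow> tensor_eq sH sH (\<Delta> b) (q b)"
    by metis
  define D where "D = (\<Union>b\<in>B. snd ` Poly_Mapping.keys (q b))"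
  have D: "finite D" "D \<subseteq> H" using B(1) q(1) by (force simp: D_def)+
  have sub: "smash.subspace (L_span D)"
    unfolding smash.subspace_def sS_eq by (auto intro: L.span_add L.span_scale L.span_zero)
  have mult: "invertible_mod sA m (tensor_mult R R')"
    if "invertible_mod sA m R" "invertible_mod sA m R'" for R R'
    using that maximal_ideal_mult[OF m]
    by (intro invertible_mod_mult \<Lambda>.A.k_algebra_axioms) (auto simp: mult.commute)
  have gen: "\<exists>R. invertible_mod sA m R \<and> (\<forall>Q. biact (tensor_mult R Q) (\<iota>L f * \<iota>H x) \<in> L_span D)"
    if "x \<in> ?C" for f x
  proof -
    let ?T = "\<lambda>R x. bilift sS (\<lambda>y z. \<iota> (pairing R y) * \<iota>H z) (\<Delta> x)"
    obtain y where y: "y \<in> \<Lambda>.span B" "x - y \<in> superfluous_coideal sH \<Delta> sA act ?C m"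
      using B(3)[OF \<open>x \<in> ?C\<close>] by blast
    have TD: "?T R y \<in> L_span D" for R
    proof -
      have "?T R b \<in> L_span D" if "b \<in> B" for b
        unfolding bilift_smash_tensor_eq[OF q(2)[OF that]]
      proof (rule bilift_in_subspace[OF _ sub])
        fix u z assume "(u, z) \<in> Poly_Mapping.keys (q b)"
        then have "z \<in> D" using that by (force simp: D_def)
        then show "\<iota> (pairing R u) * \<iota>H z \<in> L_span D"
          unfolding \<iota>_def by (intro L.span_scale L.span_base) auto
      qed simp
      then have "B \<subseteq> ?T R -` L_span D" by blast
      then show ?thesis
        using \<Lambda>.span_minimal[OF _ linear_subspace_vimage[OF linear_smash_comult sub]] y(1) by blast
    qed
    obtain p where p: "Poly_Mapping.keys p \<subseteq> superfluous_part sH \<Delta> sA act m \<times> ?C"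
      "tensor_eq sH sH (\<Delta> (x - y)) p"
      using y(2) unfolding superfluous_coideal_def tensor_sub_def by blast
    obtain R where R: "invertible_mod sA m R" "fst ` Poly_Mapping.keys p \<subseteq> annihilated R"
      using p(1) by (elim superfluous_part_annihilated[OF m, of "fst ` Poly_Mapping.keys p", rotated 2]) auto
    have "?T (tensor_mult R Q) (x - y) = 0" for Q
      unfolding bilift_smash_tensor_eq[OF p(2)]
      using R(2) by (intro bilift_zero_fun) (force simp: pairing_eq_0 \<iota>_simps)+
    moreover have "?T R' x = ?T R' (x - y) + ?T R' y" for R'
      using linear_smash_comult[of R'] unfolding Vector_Spaces.linear_iff by (metis diff_add_cancel)
    ultimately have "?T (tensor_mult R Q) x \<in> L_span D" for Q
      using TD by simp
    then show ?thesis
      using R(1) unfolding biact_smash by (blast intro: L.span_scale)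
  qed
  have "\<exists>R. invertible_mod sA m R \<and> (\<forall>Q. biact (tensor_mult R Q) X \<in> L_span D)"
    if "X \<in> smash_sub sS \<iota>L \<iota>H UNIV ?C" for X
    using that unfolding smash_sub_def
  proof (induction rule: smash.span_induct_alt)
    case base
    have "biact R 0 = 0" for R
      using linear_biact_right[of R] unfolding Vector_Spaces.linear_iff by (metis smash.scale_zero_left)
    then show ?case using invertible_mod_one L.span_zero by auto
  next
    case (step c X Y)
    from step(1) gen obtain R where R: "invertible_mod sA m R"
      "\<And>Q. biact (tensor_mult R Q) X \<in> L_span D" by blast
    from step(2) obtain R' where R': "invertible_mod sA m R'"
      "\<And>Q. biact (tensor_mult R' Q) Y \<in> L_span D" by blast
    have "biact (tensor_mult (tensor_mult R R') Q) (sS c X + Y) \<in> L_span D" for Q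
    proof -
      have "biact (tensor_mult (tensor_mult R R') Q) (sS c X + Y)
          = sS c (biact (tensor_mult (tensor_mult R R') Q) X) + biact (tensor_mult (tensor_mult R R') Q) Y"
        using linear_biact_right by (simp add: Vector_Spaces.linear_iff)
      moreover have "biact (tensor_mult (tensor_mult R R') Q) X \<in> L_span D"
        using R(2) by (simp add: tensor_mult_assoc)
      moreover have "biact (tensor_mult (tensor_mult R R') Q) Y \<in> L_span D"
        using R'(2) by (metis tensor_mult_assoc tensor_mult_commute)
      ultimately show ?thesis by (simp add: sS_eq L.span_add L.span_scale)
    qed
    with mult[OF R(1) R'(1)] show ?case by blast
  qed
  with D show ?thesis by blast
qed

end


section \<open>Weight spaces\<close>

text \<open>Powers of an ideal decrease, so one exponent decides.\<close>

lemma weight_space_iff: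
  "v \<in> weight_space \<iota>L actV m \<longleftrightarrow> (\<exists>N. \<forall>a\<in>ideal_power m N. actV (\<iota>L (to_fract a)) v = 0)"
  unfolding weight_space_def using ideal_power_antimono by blast

locale galois_order_module =
  hopf_galois_setting sH \<Delta> \<epsilon> S sA act actL sS \<iota>L \<iota>H H
  for sH :: "'k::field \<Rightarrow> 'h::ring_1 \<Rightarrow> 'h" and \<Delta> \<epsilon> S
    and sA :: "'k \<Rightarrow> 'a::idom \<Rightarrow> 'a" and act actL
    and sS :: "'k \<Rightarrow> 's::ring_1 \<Rightarrow> 's" and \<iota>L \<iota>H H +
  fixes F :: "'s set" and sV :: "'k \<Rightarrow> 'v::ab_group_add \<Rightarrow> 'v" and actV :: "'s \<Rightarrow> 'v \<Rightarrow> 'v"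
  assumes galois_order: "galois_order sA actL sS \<iota>L \<iota>H H F"
    and left_module: "left_module sS F sV actV"
begin

sublocale V: vector_space sV
  using left_module by (simp add: left_module_def)

abbreviation "W m \<equiv> weight_space \<iota>L actV m"

lemma F_closed: "0 \<in> F" "X \<in> F \<Longrightarrow> Y \<in> F \<Longrightarrow> X + Y \<in> F" "X \<in> F \<Longrightarrow> Y \<in> F \<Longrightarrow> X * Y \<in> F"
  "X \<in> F \<Longrightarrow> sS c X \<in> F" "\<iota> a \<in> F"
  using galois_order unfolding galois_order_def subalgebra_def smash.subspace_def
  by (auto simp: \<iota>_def)

lemma subspace_F: "smash.subspace F"
  by (auto simp: smash.subspace_def intro: F_closed)

lemma biact_F: "X \<in> F \<Longrightarrow> biact R X \<in> F"
  unfolding biact_def by (intro bilift_in_subspace subspace_F) (auto intro: F_closed)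

lemma linear_actV: "X \<in> F \<Longrightarrow> Vector_Spaces.linear sV sV (actV X)"
  using left_module by (simp add: left_module_def)

lemma actV_simps:
  "X \<in> F \<Longrightarrow> actV X (u + w) = actV X u + actV X w"
  "X \<in> F \<Longrightarrow> actV X (sV c u) = sV c (actV X u)"
  "X \<in> F \<Longrightarrow> Y \<in> F \<Longrightarrow> actV (X + Y) u = actV X u + actV Y u"
  "X \<in> F \<Longrightarrow> actV (sS c X) u = sV c (actV X u)"
  "X \<in> F \<Longrightarrow> Y \<in> F \<Longrightarrow> actV (X * Y) u = actV X (actV Y u)"
  "actV 1 u = u"
  using left_module by (auto simp: left_module_def Vector_Spaces.linear_iff)

lemma actV_zero: "X \<in> F \<Longrightarrow> actV X 0 = 0" "actV 0 u = 0"
  using actV_simps(2)[of X 0 0] actV_simps(4)[of 0 0 u] F_closed(1) by auto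

lemma subspace_W: "V.subspace (W m)"
  unfolding V.subspace_def
proof (intro conjI ballI allI)
  show "0 \<in> W m" by (auto simp: weight_space_def actV_zero F_closed simp flip: \<iota>_def)
  show "sV c u \<in> W m" if "u \<in> W m" for c u
    using that by (auto simp: weight_space_iff actV_simps F_closed simp flip: \<iota>_def intro: exI)
  fix u w assume "u \<in> W m" "w \<in> W m"
  then obtain N N' where N: "\<And>n a. n \<ge> N \<Longrightarrow> a \<in> ideal_power m n \<Longrightarrow> actV (\<iota> a) u = 0"
    "\<And>n a. n \<ge> N' \<Longrightarrow> a \<in> ideal_power m n \<Longrightarrow> actV (\<iota> a) w = 0"
    unfolding weight_space_def \<iota>_def by blast
  then have "\<forall>a\<in>ideal_power m (max N N'). actV (\<iota> a) (u + w) = 0"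
    by (simp add: actV_simps F_closed N[OF max.cobounded1] N[OF max.cobounded2])
  then show "u + w \<in> W m" unfolding weight_space_iff \<iota>_def by blast
qed

lemma W_actV: "u \<in> W m \<Longrightarrow> actV (\<iota> a) u \<in> W m"
proof -
  assume "u \<in> W m"
  then obtain N where N: "\<forall>b\<in>ideal_power m N. actV (\<iota> b) u = 0"
    unfolding weight_space_iff \<iota>_def by blast
  have "actV (\<iota> b) (actV (\<iota> a) u) = 0" if "b \<in> ideal_power m N" for b
  proof -
    have "actV (\<iota> b) (actV (\<iota> a) u) = actV (\<iota> (a * b)) u"
      by (subst mult.commute) (simp add: \<iota>_simps(2) actV_simps(5) F_closed)
    then show ?thesis using N ideal_power_mult[OF that, of a] by simp
  qed
  then show ?thesis unfolding weight_space_iff \<iota>_def by blast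
qed

text \<open>\<open>P\<close> takes the component in \<open>W m\<close> along the sum
  \<open>Vo\<close> of the other weight spaces. The two are complementary and stable under
  \<open>\<Lambda>\<close>, which makes \<open>P\<close> linear and compatible with
  \<open>\<Lambda>\<close>.\<close>

lemma weight_projection:
  assumes hc: "harish_chandra sA \<iota>L actV" and m: "maximal_ideal m" "fin_dim_quotient sA UNIV m"
  shows "\<exists>P. (\<forall>u. P u \<in> W m) \<and> (\<forall>w\<in>W m. P w = w) \<and> (\<forall>u w. P (u + w) = P u + P w) \<and>
    (\<forall>c u. P (sV c u) = sV c (P u)) \<and> (\<forall>a u. P (actV (\<iota> a) u) = actV (\<iota> a) (P u))"
proof -
  define M where "M = {m. maximal_ideal m \<and> fin_dim_quotient sA UNIV m}"
  have ex: "\<exists>I u. finite I \<and> I \<subseteq> M \<and> (\<forall>n\<in>I. u n \<in> W n) \<and> v = (\<Sum>n\<in>I. u n)" for v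
    using hc unfolding harish_chandra_def Let_def M_def[symmetric] by blast
  have indep: "\<And>I u n. finite I \<Longrightarrow> I \<subseteq> M \<Longrightarrow> (\<And>n. n \<in> I \<Longrightarrow> u n \<in> W n) \<Longrightarrow> (\<Sum>n\<in>I. u n) = 0 \<Longrightarrow>
      n \<in> I \<Longrightarrow> u n = 0"
    using hc unfolding harish_chandra_def Let_def M_def[symmetric] by blast
  have mM: "m \<in> M" using m by (simp add: M_def)
  define Vo where "Vo = V.span (\<Union>n\<in>M - {m}. W n)"
  have Vo_sum: "\<exists>I u. finite I \<and> I \<subseteq> M - {m} \<and> (\<forall>n. u n \<in> W n) \<and> v = (\<Sum>n\<in>I. u n)" if "v \<in> Vo" for v
    using that unfolding Vo_def
  proof (induction rule: V.span_induct_alt)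
    case base
    show ?case by (intro exI[of _ "{}"] exI[of _ "\<lambda>_. 0"]) (auto intro: V.subspace_0[OF subspace_W])
  next
    case (step c x y)
    from step(1) obtain n where n: "n \<in> M - {m}" "x \<in> W n" by blast
    from step(2) obtain I u where I: "finite I" "I \<subseteq> M - {m}" "\<And>n. u n \<in> W n" "y = (\<Sum>n\<in>I. u n)" by blast
    \<comment> \<open>The index \<open>n\<close> may already occur in \<open>I\<close>, so the two
      contributions are added rather than one replacing the other.\<close>
    let ?u = "\<lambda>j. (if j = n then sV c x else 0) + (if j \<in> I then u j else 0)"
    have "(\<Sum>j\<in>insert n I. ?u j) = sV c x + y"
      unfolding sum.distrib using I(1) by (simp add: I(4) sum.If_cases Int_absorb1 subset_insertI)
    moreover have "?u j \<in> W j" for j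
      using n(2) I(3) by (intro V.subspace_add[OF subspace_W])
        (auto intro: V.subspace_scale[OF subspace_W] V.subspace_0[OF subspace_W])
    ultimately show ?case using I n by (intro exI[of _ "insert n I"] exI[of _ ?u]) auto
  qed
  have W_Vo: "u = 0" if u: "u \<in> W m" "u \<in> Vo" for u
  proof -
    obtain I w where I: "finite I" "I \<subseteq> M - {m}" "\<And>n. w n \<in> W n" "u = (\<Sum>n\<in>I. w n)"
      using Vo_sum[OF u(2)] by blast
    \<comment> \<open>With \<open>- u\<close> placed at \<open>m\<close> the expansion becomes a
      vanishing sum of weight vectors, and directness forces \<open>u = 0\<close>.\<close>
    let ?w = "w(m := - u)"
    have "?w n \<in> W n" for n using I(3) u(1) V.subspace_neg[OF subspace_W] by auto
    moreover have "(\<Sum>n\<in>insert m I. ?w n) = 0"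
      using I(1,2,4) by (subst sum.insert) (auto intro!: sum.cong)
    ultimately have "?w m = 0" using I(1,2) mM by (intro indep[of "insert m I" ?w]) auto
    then show ?thesis by simp
  qed
  have dec: "\<exists>a. a \<in> W m \<and> v - a \<in> Vo" for v
  proof -
    obtain I u where I: "finite I" "I \<subseteq> M" "\<And>n. n \<in> I \<Longrightarrow> u n \<in> W n" "v = (\<Sum>n\<in>I. u n)"
      using ex[of v] by blast
    have Vo: "(\<Sum>n\<in>I - {m}. u n) \<in> Vo"
      unfolding Vo_def using I by (intro V.span_sum V.span_base) auto
    show ?thesis
    proof (cases "m \<in> I")
      case True
      then have "v - u m = (\<Sum>n\<in>I - {m}. u n)" using I(1,4) by (simp add: sum.remove[of I m])
      with Vo True I(3) show ?thesis by (intro exI[of _ "u m"]) simp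
    next
      case False
      with Vo I(4) show ?thesis by (intro exI[of _ 0]) (simp add: V.subspace_0[OF subspace_W])
    qed
  qed
  define P where "P v = (SOME a. a \<in> W m \<and> v - a \<in> Vo)" for v
  have P: "P v \<in> W m" "v - P v \<in> Vo" for v
    using someI_ex[OF dec[of v]] by (auto simp: P_def)
  have sub: "V.subspace Vo" by (simp add: Vo_def)
  \<comment> \<open>Uniqueness of the component: each property of \<open>P\<close> below is shown by
    exhibiting a candidate.\<close>
  have P_eq: "P v = a" if "a \<in> W m" "v - a \<in> Vo" for v a
  proof -
    have "P v - a = (v - a) - (v - P v)" by simp
    then have "P v - a \<in> Vo" using that(2) P(2) V.subspace_diff[OF sub] by metis
    with W_Vo[OF V.subspace_diff[OF subspace_W P(1) that(1)]] show ?thesis by simp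
  qed
  have Vo_act: "actV (\<iota> a) u \<in> Vo" if "u \<in> Vo" for a u
  proof -
    have "(\<Union>n\<in>M - {m}. W n) \<subseteq> actV (\<iota> a) -` Vo"
      unfolding Vo_def using W_actV V.span_superset[of "\<Union>n\<in>M - {m}. W n"] by blast
    then show ?thesis
      using that V.span_minimal[OF _ linear_subspace_vimage[OF linear_actV[OF F_closed(5)] sub]]
      unfolding Vo_def by blast
  qed
  have diff: "actV (\<iota> a) (u - w) = actV (\<iota> a) u - actV (\<iota> a) w" for a u w
    using actV_simps(1)[of "\<iota> a" "u - w" w] F_closed(5) by simp
  show ?thesis
  proof (intro exI[of _ P] conjI allI ballI)
    show "P w = w" if "w \<in> W m" for w
      using that by (intro P_eq) (simp_all add: V.subspace_0[OF sub])
    fix u w c a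
    show "P (u + w) = P u + P w"
      using V.subspace_add[OF sub P(2)[of u] P(2)[of w]] P(1)
      by (intro P_eq V.subspace_add[OF subspace_W]) (simp_all add: algebra_simps)
    show "P (sV c u) = sV c (P u)"
      using V.subspace_scale[OF sub P(2)[of u], of c] P(1)
      by (intro P_eq V.subspace_scale[OF subspace_W]) (simp_all add: V.scale_right_diff_distrib)
    show "P (actV (\<iota> a) u) = actV (\<iota> a) (P u)"
      using Vo_act[OF P(2)[of u], of a] P(1) by (intro P_eq W_actV) (simp_all add: diff)
  qed (rule P(1))
qed

text \<open>A power of \<open>m\<close> kills \<open>w\<close>, so the action on \<open>w\<close>
  factors through the quotient of \<open>\<Lambda>\<close> by that power, which is
  finite-dimensional.\<close>

lemma finite_cyclic_span:
  assumes m: "maximal_ideal m" "fin_dim_quotient sA UNIV m" and w: "w \<in> W m"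
  shows "\<exists>G. finite G \<and> (\<forall>a. actV (\<iota> a) w \<in> V.span ((\<lambda>g. actV (\<iota> g) w) ` G))"
proof -
  obtain N where N: "\<And>a. a \<in> ideal_power m N \<Longrightarrow> actV (\<iota> a) w = 0"
    using w unfolding weight_space_iff \<iota>_def by blast
  obtain G where G: "finite G" "\<And>a. \<exists>g\<in>\<Lambda>.A.span G. a - g \<in> ideal_power m N"
    using fin_dim_quotient_ideal_power[OF \<Lambda>.A.k_algebra_axioms noetherian _ m(2)] m(1)
    unfolding maximal_ideal_def by metis
  have "actV (\<iota> a) w \<in> V.span ((\<lambda>g. actV (\<iota> g) w) ` G)" for a
  proof -
    obtain g where g: "g \<in> \<Lambda>.A.span G" "a - g \<in> ideal_power m N" using G(2) by blast
    have "actV (\<iota> ((a - g) + g)) w = actV (\<iota> (a - g)) w + actV (\<iota> g) w"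
      unfolding \<iota>_simps(1) by (rule actV_simps) (rule F_closed)+
    then have "actV (\<iota> a) w = actV (\<iota> g) w" using N[OF g(2)] by simp
    moreover have lin: "Vector_Spaces.linear sA sV (\<lambda>g. actV (\<iota> g) w)"
      by (simp add: Vector_Spaces.linear_iff \<iota>_simps actV_simps F_closed V.vector_space_axioms)
    have "actV (\<iota> g) w \<in> V.span ((\<lambda>g. actV (\<iota> g) w) ` G)"
    proof -
      have "G \<subseteq> (\<lambda>g. actV (\<iota> g) w) -` V.span ((\<lambda>g. actV (\<iota> g) w) ` G)"
        by (auto intro: V.span_base)
      then show ?thesis
        using g(1) \<Lambda>.A.span_minimal[OF _ linear_subspace_vimage[OF lin V.subspace_span]] by blast
    qed
    ultimately show ?thesis by simp
  qed
  with G(1) show ?thesis by blast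
qed

text \<open>The indices \<open>i\<close> and \<open>j\<close> drop separately under \<open>m \<otimes> \<Lambda>\<close> and \<open>\<Lambda> \<otimes> m\<close>; see \<open>kills_biact\<close>.\<close>

definition kills :: "('v \<Rightarrow> 'v) \<Rightarrow> 'v \<Rightarrow> 'a set \<Rightarrow> nat \<Rightarrow> nat \<Rightarrow> 's \<Rightarrow> bool"
  where "kills P v m i j Z \<longleftrightarrow> Z \<in> F \<and>
    (\<forall>a\<in>ideal_power m i. \<forall>b. P (actV (\<iota> a * Z * \<iota> b) v) = 0) \<and>
    (\<forall>a. \<forall>b\<in>ideal_power m j. P (actV (\<iota> a * Z * \<iota> b) v) = 0)"

section \<open>Nilpotence of \<open>\<Lambda> \<otimes> m + m \<otimes> \<Lambda>\<close> on
  \<open>P (X v)\<close>\<close>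

context
  fixes P :: "'v \<Rightarrow> 'v" and v :: 'v
  assumes P_add: "\<And>u w. P (u + w) = P u + P w"
    and P_scale: "\<And>c u. P (sV c u) = sV c (P u)"
begin

abbreviation "\<Phi> Z \<equiv> P (actV Z v)"

lemma \<Phi>_add: "X \<in> F \<Longrightarrow> Y \<in> F \<Longrightarrow> \<Phi> (X + Y) = \<Phi> X + \<Phi> Y"
  by (simp add: actV_simps P_add)

lemma P_zero: "P 0 = 0"
  using P_scale[of 0 0] by simp

text \<open>The elements on which the functional vanishes form a subspace, so each term of
  \<open>R\<close> can be tested separately.\<close>

lemma \<Phi>_biact_eq_0:
  assumes Z: "Z \<in> F"
    and "\<And>r s. (r, s) \<in> Poly_Mapping.keys R \<Longrightarrow> \<Phi> (\<iota> (a * r) * Z * \<iota> (s * b)) = 0"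
  shows "\<Phi> (\<iota> a * biact R Z * \<iota> b) = 0"
proof -
  let ?K = "{Y \<in> F. \<Phi> (\<iota> a * Y * \<iota> b) = 0}"
  have "smash.subspace ?K"
    by (auto simp: smash.subspace_def F_closed actV_zero P_zero distrib_left distrib_right
        smash.scale_mult_left smash.scale_mult_right actV_simps P_add P_scale)
  then have "biact R Z \<in> ?K"
    unfolding biact_def using assms
    by (intro bilift_in_subspace) (simp_all add: F_closed \<iota>_simps mult.assoc)
  then show ?thesis by simp
qed

text \<open>A right factor in \<open>m\<close> raises the power of \<open>m\<close> containing
  \<open>b\<close> by one, a left factor that of \<open>a\<close>. The other condition persists
  because powers of \<open>m\<close> are ideals.\<close>

lemma kills_biact:
  assumes Z: "kills P v m i j Z"
  shows "Poly_Mapping.keys p \<subseteq> UNIV \<times> m \<Longrightarrow> kills P v m i (j - 1) (biact p Z)"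
    and "Poly_Mapping.keys q \<subseteq> m \<times> UNIV \<Longrightarrow> kills P v m (i - 1) j (biact q Z)"
proof -
  have F: "Z \<in> F" and i: "\<And>a b. a \<in> ideal_power m i \<Longrightarrow> \<Phi> (\<iota> a * Z * \<iota> b) = 0"
    and j: "\<And>a b. b \<in> ideal_power m j \<Longrightarrow> \<Phi> (\<iota> a * Z * \<iota> b) = 0"
    using Z by (auto simp: kills_def)
  \<comment> \<open>Truncated subtraction at \<open>n = 0\<close> is harmless, since the zeroth
    power is the whole ring.\<close>
  have shift: "s * b \<in> ideal_power m n" if "s \<in> m" "b \<in> ideal_power m (n - 1)" for s b n
    using that mult_in_ideal_power_Suc[of s m b "n - 1"] by (cases n) auto
  show "kills P v m i (j - 1) (biact p Z)" if p: "Poly_Mapping.keys p \<subseteq> UNIV \<times> m"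
    unfolding kills_def
  proof (intro conjI ballI allI biact_F F \<Phi>_biact_eq_0)
    fix a b r s assume "a \<in> ideal_power m i"
    then show "\<Phi> (\<iota> (a * r) * Z * \<iota> (s * b)) = 0"
      using ideal_power_mult[of a m i r] by (intro i) (simp add: mult.commute)
  next
    fix a b r s assume "b \<in> ideal_power m (j - 1)" "(r, s) \<in> Poly_Mapping.keys p"
    then show "\<Phi> (\<iota> (a * r) * Z * \<iota> (s * b)) = 0"
      using p by (intro j shift) auto
  qed
  show "kills P v m (i - 1) j (biact q Z)" if q: "Poly_Mapping.keys q \<subseteq> m \<times> UNIV"
    unfolding kills_def
  proof (intro conjI ballI allI biact_F F \<Phi>_biact_eq_0)
    fix a b r s assume "a \<in> ideal_power m (i - 1)" "(r, s) \<in> Poly_Mapping.keys q"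
    then show "\<Phi> (\<iota> (a * r) * Z * \<iota> (s * b)) = 0"
      using q shift[of r a i] by (intro i) (auto simp: mult.commute)
  next
    fix a b r s assume "b \<in> ideal_power m j"
    then show "\<Phi> (\<iota> (a * r) * Z * \<iota> (s * b)) = 0"
      by (intro j ideal_power_mult)
  qed
qed

lemma biact_iterate_F: "Z \<in> F \<Longrightarrow> (biact u ^^ n) Z \<in> F"
  by (induction n) (auto intro: biact_F)

lemma biact_iterate_add: "(biact u ^^ n) (X + Y) = (biact u ^^ n) X + (biact u ^^ n) Y"
  by (induction n) (use linear_biact_right in \<open>auto simp: Vector_Spaces.linear_iff\<close>)

text \<open>Each application of \<open>p\<close> lowers \<open>j\<close> and each application of
  \<open>q\<close> lowers \<open>i\<close>. Once an index is zero, the unit belongs to the zeroth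
  power and the functional vanishes. The disjuncts \<open>i = 0\<close> and \<open>j = 0\<close>
  carry the induction past truncated subtraction.\<close>

lemma biact_nilpotent:
  assumes p: "Poly_Mapping.keys p \<subseteq> UNIV \<times> m" and q: "Poly_Mapping.keys q \<subseteq> m \<times> UNIV"
    and "kills P v m i j Z" "i = 0 \<or> j = 0 \<or> i + j \<le> n"
  shows "\<Phi> ((biact (p + q) ^^ n) Z) = 0"
  using assms(3,4)
proof (induction n arbitrary: i j Z)
  case 0
  then have "\<Phi> (\<iota> 1 * Z * \<iota> 1) = 0" unfolding kills_def by auto
  then show ?case by (simp add: \<iota>_simps)
next
  case (Suc n)
  have Z: "Z \<in> F" using Suc.prems(1) by (simp add: kills_def)
  have "(biact (p + q) ^^ Suc n) Z = (biact (p + q) ^^ n) (biact p Z + biact q Z)"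
    using linear_biact_left[of Z] by (simp add: funpow_Suc_right Vector_Spaces.linear_iff del: funpow.simps)
  then have "\<Phi> ((biact (p + q) ^^ Suc n) Z) = \<Phi> ((biact (p + q) ^^ n) (biact p Z)) + \<Phi> ((biact (p + q) ^^ n) (biact q Z))"
    by (simp only: biact_iterate_add \<Phi>_add[OF biact_iterate_F[OF biact_F[OF Z]] biact_iterate_F[OF biact_F[OF Z]]])
  also have "\<dots> = 0"
  proof -
    have "i = 0 \<or> j - 1 = 0 \<or> i + (j - 1) \<le> n" "i - 1 = 0 \<or> j = 0 \<or> i - 1 + j \<le> n"
      using Suc.prems(2) by linarith+
    then show ?thesis
      by (simp only: Suc.IH[OF kills_biact(1)[OF Suc.prems(1) p]]
          Suc.IH[OF kills_biact(2)[OF Suc.prems(1) q]] add_0)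
  qed
  finally show ?case .
qed

text \<open>With \<open>u = p + q\<close>, the product \<open>R Q\<close> acts as
  \<open>1 + u\<close>, so the values at consecutive iterates of \<open>u\<close> on
  \<open>X\<close> add up to an element of \<open>U\<close>. The iterate \<open>i + j\<close> has
  value zero, and descending from there reaches \<open>X\<close> itself, in place of a Neumann
  series.\<close>

lemma invertible_reduction:
  assumes R: "invertible_mod sA m R" and X: "kills P v m i j X"
    and U: "V.subspace U" "\<And>Q. \<Phi> (biact (tensor_mult R Q) X) \<in> U"
  shows "\<Phi> X \<in> U"
proof -
  obtain Q p q where p: "Poly_Mapping.keys p \<subseteq> UNIV \<times> m" and q: "Poly_Mapping.keys q \<subseteq> m \<times> UNIV"
    and Q: "tensor_eq sA sA (tensor_mult R Q) (pure_tensor 1 1 + (p + q))"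
    using invertible_modE[OF R] .
  have F: "X \<in> F" using X by (simp add: kills_def)
  let ?X = "\<lambda>n. (biact (p + q) ^^ n) X"
  \<comment> \<open>\<open>U(2)\<close> speaks of multiples of \<open>R\<close> acting on
    \<open>X\<close>, so every iterate has to be the action of a single formal sum.\<close>
  have power: "\<exists>T. ?X n = biact T X" for n
  proof (induction n)
    case 0
    show ?case by (intro exI[of _ "pure_tensor 1 1"]) (simp add: biact_pure \<iota>_simps)
  next
    case (Suc n)
    then obtain T where "?X n = biact T X" by blast
    then show ?case by (intro exI[of _ "tensor_mult (p + q) T"]) (simp add: biact_tensor_mult)
  qed
  have steps: "\<Phi> (?X n) + \<Phi> (?X (Suc n)) \<in> U" for n
  proof -
    obtain T where T: "?X n = biact T X" using power by blast
    have "biact (tensor_mult R (tensor_mult Q T)) X = biact (tensor_mult R Q) (?X n)"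
      by (simp add: T biact_tensor_mult)
    also have "\<dots> = ?X n + ?X (Suc n)"
      using linear_biact_left[of "?X n"]
      by (simp add: biact_tensor_eq[OF Q] biact_pure \<iota>_simps Vector_Spaces.linear_iff)
    finally show ?thesis
      using U(2)[of "tensor_mult Q T"] \<Phi>_add biact_iterate_F[OF F] by metis
  qed
  have "\<Phi> (?X (i + j)) = 0"
    by (rule biact_nilpotent[OF p q X]) simp
  then have last: "\<Phi> (?X (i + j)) \<in> U" using V.subspace_0[OF U(1)] by simp
  have "\<Phi> (?X n) \<in> U" if "n \<le> i + j" for n
    using that
  proof (induction n rule: inc_induct)
    case base
    show ?case by (rule last)
  next
    case (step n)
    then show ?case
      using V.subspace_diff[OF U(1) steps[of n] step.IH] by simp
  qed
  from this[of 0] show ?thesis by simp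
qed

end

text \<open>The power of \<open>m\<close> that kills \<open>v\<close> gives \<open>j\<close>. For
  \<open>i\<close>, the vectors \<open>b v\<close> with \<open>b \<in> \<Lambda>\<close> span a
  finite-dimensional space, so only finitely many vectors \<open>P (X g v)\<close> of the weight
  space have to be killed by a common power.\<close>

lemma kills_exists:
  assumes m: "maximal_ideal m" "fin_dim_quotient sA UNIV m" and v: "v \<in> W m" and X: "X \<in> F"
    and P: "\<And>u. P u \<in> W m" "\<And>u w. P (u + w) = P u + P w" "\<And>c u. P (sV c u) = sV c (P u)"
    "\<And>a u. P (actV (\<iota> a) u) = actV (\<iota> a) (P u)"
  shows "\<exists>i j. kills P v m i j X"
proof -
  obtain j where j: "\<And>b. b \<in> ideal_power m j \<Longrightarrow> actV (\<iota> b) v = 0"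
    using v unfolding weight_space_iff \<iota>_def by blast
  obtain G where G: "finite G" "\<And>b. actV (\<iota> b) v \<in> V.span ((\<lambda>g. actV (\<iota> g) v) ` G)"
    using finite_cyclic_span[OF m v] by blast
  have "\<exists>N. \<forall>n\<ge>N. \<forall>a\<in>ideal_power m n. actV (\<iota> a) (P (actV X (actV (\<iota> g) v))) = 0" for g
    using P(1)[of "actV X (actV (\<iota> g) v)"] unfolding weight_space_def \<iota>_def by blast
  then obtain N where N: "\<And>g n a. n \<ge> N g \<Longrightarrow> a \<in> ideal_power m n \<Longrightarrow>
      actV (\<iota> a) (P (actV X (actV (\<iota> g) v))) = 0" by metis
  \<comment> \<open>For empty \<open>G\<close> the maximum is unspecified, but then the span is zero
    and any \<open>i\<close> will do.\<close>
  define i where "i = Max (N ` G)"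
  have lin: "Vector_Spaces.linear sV sV (\<lambda>y. actV (\<iota> a) (P (actV X y)))" for a
    using X by (simp add: Vector_Spaces.linear_iff V.vector_space_axioms actV_simps F_closed P)
  have "actV (\<iota> a) (P (actV X (actV (\<iota> b) v))) = 0" if a: "a \<in> ideal_power m i" for a b
  proof -
    have "(\<lambda>g. actV (\<iota> g) v) ` G \<subseteq> (\<lambda>y. actV (\<iota> a) (P (actV X y))) -` {0}"
    proof -
      have "N g \<le> i" if "g \<in> G" for g using G(1) that by (simp add: i_def)
      then show ?thesis using N a by blast
    qed
    then show ?thesis
      using G(2)[of b] V.span_minimal[OF _ linear_subspace_vimage[OF lin V.subspace_single_0]] by blast
  qed
  moreover have "P 0 = 0" using P(3)[of 0 0] by simp
  ultimately have "kills P v m i j X"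
    using X j by (simp add: kills_def actV_simps F_closed P(4) actV_zero)
  then show ?thesis by blast
qed

lemma fin_dim_weight_space:
  assumes m: "maximal_ideal m" "fin_dim_quotient sA UNIV m"
    and hc: "harish_chandra sA \<iota>L actV" and v: "v \<in> W m"
    and gen: "UNIV = {actV X v | X. X \<in> galois_order_filtration sH \<Delta> sS \<iota>L \<iota>H H F r}"
    and stab: "fin_dim_Stab sH \<Delta> sA act (coideal_filtration sH \<Delta> H r) m"
  shows "fin_dim sV (W m)"
proof -
  interpret M: module "\<lambda>a X. \<iota> a * X" by (rule module_\<iota>)
  obtain P where P: "\<And>u. P u \<in> W m" "\<And>w. w \<in> W m \<Longrightarrow> P w = w"
    "\<And>u w. P (u + w) = P u + P w" "\<And>c u. P (sV c u) = sV c (P u)"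
    "\<And>a u. P (actV (\<iota> a) u) = actV (\<iota> a) (P u)"
    using weight_projection[OF hc m] by blast
  obtain D where D: "finite D" "D \<subseteq> H"
    "\<And>X. X \<in> smash_sub sS \<iota>L \<iota>H UNIV (coideal_filtration sH \<Delta> H r) \<Longrightarrow>
      \<exists>R. invertible_mod sA m R \<and> (\<forall>Q. biact (tensor_mult R Q) X \<in> L_span D)"
    using reduction_to_finite[OF m(1) stab] by blast
  obtain G where G: "finite G" "G \<subseteq> F \<inter> L_span D" "F \<inter> L_span D \<subseteq> M.span G"
    using galois_order_finitely_generated[OF galois_order D(1,2)] by blast
  \<comment> \<open>Each \<open>P (g v)\<close> is a weight vector, so its
    \<open>\<Lambda>\<close>-orbit spans a finite-dimensional space; \<open>B\<close> collects
    spanning sets for the generators \<open>g \<in> G\<close>.\<close>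
  have "\<exists>A. finite A \<and> (\<forall>a. actV (\<iota> a) (P (actV g v)) \<in> V.span ((\<lambda>b. actV (\<iota> b) (P (actV g v))) ` A))" for g
    by (rule finite_cyclic_span[OF m P(1)])
  then obtain A where A: "\<And>g. finite (A g)"
    "\<And>g a. actV (\<iota> a) (P (actV g v)) \<in> V.span ((\<lambda>b. actV (\<iota> b) (P (actV g v))) ` A g)"
    by metis
  define B where "B = (\<Union>g\<in>G. (\<lambda>b. actV (\<iota> b) (P (actV g v))) ` A g)"
  have B: "finite B" "B \<subseteq> W m"
    using G(1) A(1) P(1) W_actV by (auto simp: B_def)
  have G_B: "actV (\<iota> a) (P (actV g v)) \<in> V.span B" if "g \<in> G" for a g
    using A(2)[of a g] V.span_mono[of "(\<lambda>b. actV (\<iota> b) (P (actV g v))) ` A g" B] that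
    by (auto simp: B_def)
  \<comment> \<open>Membership in \<open>F\<close> is carried through the induction because the
    module laws for \<open>actV\<close> hold only there.\<close>
  have "Y \<in> F \<and> P (actV Y v) \<in> V.span B" if "Y \<in> M.span G" for Y
    using that
  proof (induction rule: M.span_induct_alt)
    case base
    have "P 0 = 0" using P(4)[of 0 0] by simp
    then show ?case by (simp add: actV_zero F_closed V.span_zero)
  next
    case (step a g Y)
    then have g: "g \<in> F" using G(2) by blast
    with step show ?case
      by (simp add: F_closed actV_simps P G_B V.span_add)
  qed
  then have N: "P (actV Y v) \<in> V.span B" if "Y \<in> F" "Y \<in> L_span D" for Y
    using that G(3) by blast
  have "W m \<subseteq> V.span B"
  proof
    fix w assume w: "w \<in> W m"
    obtain X where X: "X \<in> F" "X \<in> smash_sub sS \<iota>L \<iota>H UNIV (coideal_filtration sH \<Delta> H r)" "w = actV X v"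
      using gen unfolding galois_order_filtration_def by blast
    obtain R where R: "invertible_mod sA m R" "\<And>Q. biact (tensor_mult R Q) X \<in> L_span D"
      using D(3)[OF X(2)] by blast
    obtain i j where kills: "kills P v m i j X"
      using kills_exists[OF m v X(1) P(1,3,4,5)] by blast
    \<comment> \<open>All multiples of \<open>R\<close> move \<open>X\<close> into
      \<open>F \<inter> L D\<close>, so their values lie in the span of \<open>B\<close>;
      invertibility of \<open>R\<close> transfers this to \<open>X\<close>.\<close>
    have "P (actV X v) \<in> V.span B"
      using N R(2) biact_F[OF X(1)]
      by (intro invertible_reduction[OF P(3,4) R(1) kills V.subspace_span]) blast
    then show "w \<in> V.span B" using P(2)[OF w] X(3) by simp
  qed
  with B show ?thesis unfolding fin_dim_def by blast
qed

end

theorem theorem4p25: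
  fixes sH :: "'k::field \<Rightarrow> 'h::ring_1 \<Rightarrow> 'h"
    and \<Delta> :: "'h \<Rightarrow> ('h \<times> 'h) \<Rightarrow>\<^sub>0 'k" and \<epsilon> :: "'h \<Rightarrow> 'k" and S :: "'h \<Rightarrow> 'h"
    and sA :: "'k \<Rightarrow> 'a::idom \<Rightarrow> 'a"
    and act :: "'h \<Rightarrow> 'a \<Rightarrow> 'a" and actL :: "'h \<Rightarrow> 'a fract \<Rightarrow> 'a fract"
    and sS :: "'k \<Rightarrow> 's::ring_1 \<Rightarrow> 's" and \<iota>L :: "'a fract \<Rightarrow> 's" and \<iota>H :: "'h \<Rightarrow> 's"
    and H :: "'h set" and F :: "'s set" and m :: "'a set"
    and sV :: "'k \<Rightarrow> 'v::ab_group_add \<Rightarrow> 'v" and actV :: "'s \<Rightarrow> 'v \<Rightarrow> 'v"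
    and r :: nat and v :: 'v
  assumes "hopf_galois_setting sH \<Delta> \<epsilon> S sA act actL sS \<iota>L \<iota>H H"
    and "galois_order sA actL sS \<iota>L \<iota>H H F"
    and "maximal_ideal m" and "fin_dim_quotient sA UNIV m"
    and "left_module sS F sV actV" and "harish_chandra sA \<iota>L actV"
    and "v \<in> weight_space \<iota>L actV m"
    and "UNIV = {actV X v | X. X \<in> galois_order_filtration sH \<Delta> sS \<iota>L \<iota>H H F r}"
    and "fin_dim_Stab sH \<Delta> sA act (coideal_filtration sH \<Delta> H r) m"
  shows "fin_dim sV (weight_space \<iota>L actV m)"
proof -
  interpret galois_order_module sH \<Delta> \<epsilon> S sA act actL sS \<iota>L \<iota>H H F sV actV
    using assms(1,2,5) by (simp add: galois_order_module_def galois_order_module_axioms_def)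
  show ?thesis using assms(3,4,6-9) by (rule fin_dim_weight_space)
qed

end
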